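(* Let $k$ be an algebraically closed field of characteristic zero and let $n,m,d$ be positive integers. Let $G=\mathrm{GL}_n(k)\times \mathrm{GL}_m(k)$ act on $$W(n,m,d)=M_{n\times m}(k)^d\oplus M_{m\times n}(k)^d$$ by $(g_1,g_2)\cdot\big((Q_i)_{i},(R_i)_{i}\big)=\big((g_1Q_ig_2^{-1})_{i},(g_2R_ig_1^{-1})_{i}\big)$. Then the $k$-algebra of invariants $k[W(n,m,d)]^G$ is generated by the polynomial functions $$\big((Q_i)_i,(R_i)_i\big)\longmapsto \mathrm{Tr}(M_1M_2\cdots M_l),\qquad M_i=Q_{n_i}R_{m_i},$$ where $l\ge 1$ and $n_i,m_i\in\{1,\dots,d\}$ for all $i\in\{1,\dots,l\}$.
   Context: $M_{a\times b}(k)$ is the space of $a\times b$ matrices over $k$. $k[W]$ denotes the algebra of polynomial functions on a finite-dimensional vector space $W$. *)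

theory Defs
  imports "HOL-Analysis.Analysis" "HOL-Computational_Algebra.Computational_Algebra"
begin

text \<open>
  The unital subalgebra generated by \<open>S\<close> in the algebra of all functions from \<open>'w\<close> to \<open>'k\<close>
  (pointwise operations).  Constants are included, so closure under scalar multiplication
  follows from closure under multiplication.
\<close>

inductive_set alg_generated :: "('w \<Rightarrow> 'k::comm_ring_1) set \<Rightarrow> ('w \<Rightarrow> 'k) set"
  for S :: "('w \<Rightarrow> 'k) set" where
  base: "f \<in> S \<Longrightarrow> f \<in> alg_generated S"
| const: "(\<lambda>_. c) \<in> alg_generated S"
| add: "f \<in> alg_generated S \<Longrightarrow> g \<in> alg_generated S \<Longrightarrow> (\<lambda>w. f w + g w) \<in> alg_generated S"
| mult: "f \<in> alg_generated S \<Longrightarrow> g \<in> alg_generated S \<Longrightarrow> (\<lambda>w. f w * g w) \<in> alg_generated S"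

text \<open>
  The polynomial functions on a (finite-dimensional) vector space with scalar multiplication
  \<open>scl\<close>: the algebra of functions generated by the linear forms.
\<close>

definition polynomial_functions ::
  "('k::field \<Rightarrow> 'w \<Rightarrow> 'w::ab_group_add) \<Rightarrow> ('w \<Rightarrow> 'k) set" where
  "polynomial_functions scl = alg_generated {f. Vector_Spaces.linear scl (*) f}"

text \<open>
  \<open>'k^'m^'n\<close> is the type of matrices with rows indexed by \<open>'n\<close> and columns indexed by \<open>'m\<close>.
  With \<open>n\<close>, \<open>m\<close>, \<open>d\<close> the (automatically positive) cardinalities of the index types,
  the following type is \<open>W(n,m,d)\<close>.
\<close>

type_synonym ('k, 'n, 'm, 'd) W = "(('k^'m^'n)^'d) \<times> (('k^'n^'m)^'d)"

definition scaleW :: "'k::field \<Rightarrow> ('k, 'n::finite, 'm::finite, 'd::finite) W \<Rightarrow> ('k, 'n, 'm, 'd) W" where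
  "scaleW c = (\<lambda>(Q, R). (\<chi> i a b. c * Q $ i $ a $ b, \<chi> i a b. c * R $ i $ a $ b))"

lemma vector_space_scaleW: "vector_space scaleW"
  by standard (auto simp: scaleW_def vec_eq_iff algebra_simps)

definition GL :: "('k::field^'n^'n) set" where
  "GL = {g. invertible g}"

definition actW ::
  "('k::field^'n^'n) \<times> ('k^'m^'m) \<Rightarrow> ('k, 'n::finite, 'm::finite, 'd::finite) W \<Rightarrow> ('k, 'n, 'm, 'd) W" where
  "actW = (\<lambda>(g1, g2) (Q, R).
     (\<chi> i. g1 ** Q $ i ** matrix_inv g2, \<chi> i. g2 ** R $ i ** matrix_inv g1))"

definition invariantsW :: "(('k::field, 'n::finite, 'm::finite, 'd::finite) W \<Rightarrow> 'k) set" where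
  "invariantsW = {f \<in> polynomial_functions scaleW. \<forall>g \<in> GL \<times> GL. \<forall>w. f (actW g w) = f w}"

text \<open>The function \<open>Tr(M\<^sub>1 \<cdots> M\<^sub>l)\<close>; the list consists of the index pairs \<open>(n\<^sub>i, m\<^sub>i)\<close>.\<close>

definition trace_fun ::
  "('d \<times> 'd) list \<Rightarrow> ('k::field, 'n::finite, 'm::finite, 'd::finite) W \<Rightarrow> 'k" where
  "trace_fun ps = (\<lambda>(Q, R). trace (foldr (**) (map (\<lambda>(i, j). Q $ i ** R $ j) ps) (mat 1)))"

end

theory Submission
  imports Defs "HOL-Library.Function_Algebras" "HOL-Combinatorics.Permutations"
begin

text \<open>Invariance of \<open>f\<close> gives the exchange law \<open>f (g\<^sub>1 Q, g\<^sub>2 R) = f (Q g\<^sub>2, R g\<^sub>1)\<close>, first for invertible and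
  then, by density, for all square matrices. It passes to the bihomogeneous parts, forces the bidegrees to
  be of the form \<open>(s, s)\<close>, and says that the coefficient matrix of the polarization commutes with
  \<open>g\<^sub>1 \<otimes> \<dots> \<otimes> g\<^sub>1 \<otimes> g\<^sub>2 \<otimes> \<dots> \<otimes> g\<^sub>2\<close>. By polarization these tensor powers span all matrices that are
  invariant under \<open>S\<^sub>s \<times> S\<^sub>s\<close>, so by the double centralizer property the coefficient matrix is a
  combination of permutation matrices. Each pair of permutations contributes a product of traces, one for
  every cycle.\<close>


no_notation fps_nth (infixl "$" 75)

text \<open>The exchange form of invariance contains no inverses, so both sides are polynomial in
  \<open>g1\<close> and \<open>g2\<close>. Left factors act on row indices and right factors on
  column indices, which is what turns the law into an identity T M = M T. Singular matrices are
  indispensable: the tensor powers that polarization produces are powers of sums of matrix units,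
  which are rarely invertible. With equal degrees s in Q and R, the coefficients form an
  endomorphism of the s-fold tensor power of k^n tensored with that of k^m: the row indices of Q and
  R label the source, their column indices the target. A pair of permutations then glues columns of
  R to rows of Q and columns of Q to rows of R, so every cycle reads an alternating word in Q and R.
  A single permanent identity serves both polarizations, that of matrices and that of polynomials.
  The double centralizer step rests on averaging alone, without structure theory of semisimple
  algebras. Characteristic zero permits division by the number of permutation pairs and by the
  square of s!, and makes polynomial functions determine their coefficients.\<close>

section \<open>Permanents by inclusion and exclusion\<close>

text \<open>Ryser's formula for the permanent. Expanding the product gives one term for each map
  \<phi> from S to S; the alternating sum over the sets T containing its image vanishes unless
  \<phi> is onto, hence a permutation.\<close>

lemma alternating_sum_prod_eq_sum_permutes:
  fixes x :: "'s \<Rightarrow> 's \<Rightarrow> 'k::comm_ring_1"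
  assumes S: "finite S"
  shows "(\<Sum>T\<in>Pow S. (-1) ^ (card S - card T) * (\<Prod>t\<in>S. \<Sum>t'\<in>T. x t' t))
    = (\<Sum>\<sigma> | \<sigma> permutes S. \<Prod>t\<in>S. x (\<sigma> t) t)"
proof -
  let ?F = "S \<rightarrow>\<^sub>E S"
  have finF: "finite ?F" using S by (intro finite_PiE) auto
  have expand: "(\<Prod>t\<in>S. \<Sum>t'\<in>T. x t' t)
      = (\<Sum>\<phi>\<in>?F. (if \<phi> ` S \<subseteq> T then 1 else 0) * (\<Prod>t\<in>S. x (\<phi> t) t))" if "T \<subseteq> S" for T
  proof -
    have "(\<Prod>t\<in>S. \<Sum>t'\<in>T. x t' t) = (\<Sum>\<phi>\<in>S \<rightarrow>\<^sub>E T. \<Prod>t\<in>S. x (\<phi> t) t)"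
      using S that finite_subset by (intro prod_sum_PiE) auto
    also have "S \<rightarrow>\<^sub>E T = {\<phi> \<in> ?F. \<phi> ` S \<subseteq> T}" 
      using that by (auto simp: PiE_iff extensional_def)
    also have "(\<Sum>\<phi>\<in>{\<phi> \<in> ?F. \<phi> ` S \<subseteq> T}. \<Prod>t\<in>S. x (\<phi> t) t)
        = (\<Sum>\<phi>\<in>?F. if \<phi> ` S \<subseteq> T then (\<Prod>t\<in>S. x (\<phi> t) t) else 0)"
      by (rule sum.inter_filter[OF finF])
    also have "\<dots> = (\<Sum>\<phi>\<in>?F. (if \<phi> ` S \<subseteq> T then 1 else 0) * (\<Prod>t\<in>S. x (\<phi> t) t))"
      by (intro sum.cong) auto
    finally show ?thesis .
  qed
  have sign: "(\<Sum>T\<in>Pow S. (-1) ^ (card S - card T) * (if \<phi> ` S \<subseteq> T then 1 else 0))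
      = (if \<phi> ` S = S then 1 else (0::'k))" if "\<phi> \<in> ?F" for \<phi>
  proof -
    have im: "\<phi> ` S \<subseteq> S" using that by auto
    \<comment> \<open>The indicator of \<phi>(S) being inside T is a product over S - T of the
      indicators that t is outside the image. This makes the sum the expansion of a product of
      differences, each 1 or 0.\<close>
    have "(\<Sum>T\<in>Pow S. (-1) ^ (card S - card T) * (if \<phi> ` S \<subseteq> T then 1 else (0::'k)))
        = (\<Sum>T\<in>Pow S. (-1) ^ (card S - card T) * (\<Prod>t\<in>T. 1)
            * (\<Prod>t\<in>S - T. if t \<in> \<phi> ` S then 0 else 1))"
    proof (intro sum.cong refl)
      fix T assume "T \<in> Pow S"
      have "(\<Prod>t\<in>S - T. if t \<in> \<phi> ` S then 0 else (1::'k)) = (if \<phi> ` S \<subseteq> T then 1 else 0)"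
      proof (cases "\<phi> ` S \<subseteq> T")
        case True
        then show ?thesis by (auto intro!: prod.neutral)
      next
        case False
        then obtain t where "t \<in> \<phi> ` S" "t \<notin> T" by auto
        moreover have "t \<in> S - T" using calculation im by auto
        ultimately show ?thesis using S False by (intro trans[OF prod_zero]) auto
      qed
      then show "(-1) ^ (card S - card T) * (if \<phi> ` S \<subseteq> T then 1 else (0::'k))
        = (-1) ^ (card S - card T) * (\<Prod>t\<in>T. 1) * (\<Prod>t\<in>S - T. if t \<in> \<phi> ` S then 0 else 1)"
        by simp
    qed
    also have "\<dots> = (\<Prod>t\<in>S. 1 - (if t \<in> \<phi> ` S then 0 else 1))"
      by (rule prod_diff_conv_sum'[OF S, symmetric])
    also have "\<dots> = (if \<phi> ` S = S then 1 else 0)"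
    proof (cases "\<phi> ` S = S")
      case True
      then show ?thesis by (auto intro!: prod.neutral)
    next
      case False
      then obtain t where "t \<in> S" "t \<notin> \<phi> ` S" using im by auto
      then show ?thesis using S False by (intro trans[OF prod_zero]) auto
    qed
    finally show ?thesis .
  qed
  have "(\<Sum>T\<in>Pow S. (-1) ^ (card S - card T) * (\<Prod>t\<in>S. \<Sum>t'\<in>T. x t' t))
      = (\<Sum>T\<in>Pow S. \<Sum>\<phi>\<in>?F. (-1) ^ (card S - card T) * (if \<phi> ` S \<subseteq> T then 1 else 0)
          * (\<Prod>t\<in>S. x (\<phi> t) t))"
    by (intro sum.cong refl) (simp add: expand sum_distrib_left mult.assoc)
  also have "\<dots> = (\<Sum>\<phi>\<in>?F. (\<Sum>T\<in>Pow S. (-1) ^ (card S - card T) * (if \<phi> ` S \<subseteq> T then 1 else 0))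
          * (\<Prod>t\<in>S. x (\<phi> t) t))"
    by (subst sum.swap) (simp add: sum_distrib_right)
  also have "\<dots> = (\<Sum>\<phi>\<in>?F. if \<phi> ` S = S then (\<Prod>t\<in>S. x (\<phi> t) t) else 0)"
    by (intro sum.cong refl) (simp add: sign)
  also have "\<dots> = (\<Sum>\<phi>\<in>{\<phi> \<in> ?F. \<phi> ` S = S}. \<Prod>t\<in>S. x (\<phi> t) t)"
    by (rule sum.inter_filter[OF finF, symmetric])
  also have "\<dots> = (\<Sum>\<sigma> | \<sigma> permutes S. \<Prod>t\<in>S. x (\<sigma> t) t)"
  \<comment> \<open>Two conventions for values outside S meet here: \<open>undefined\<close> for the
    maps in \<open>PiE\<close>, the identity for permutations.\<close>
  proof (rule sum.reindex_bij_witness[where i = "\<lambda>\<sigma>. restrict \<sigma> S"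
        and j = "\<lambda>\<phi> t. if t \<in> S then \<phi> t else t"], goal_cases)
    case (1 \<phi>)
    then show ?case by (auto simp: PiE_def extensional_def restrict_def fun_eq_iff)
  next
    case (2 \<phi>)
    then have im: "\<phi> ` S = S" by auto
    then have "inj_on \<phi> S" using S by (intro eq_card_imp_inj_on) auto
    then have "bij_betw \<phi> S S" using im by (simp add: bij_betw_def)
    then have "bij_betw (\<lambda>t. if t \<in> S then \<phi> t else t) S S"
      by (rule iffD1[OF bij_betw_cong, rotated]) auto
    then show ?case by (auto intro!: bij_imp_permutes)
  next
    case (3 \<sigma>)
    then show ?case by (auto simp: fun_eq_iff permutes_not_in)
  next
    case (4 \<sigma>)
    then show ?case using permutes_image[of \<sigma> S] permutes_in_image[of \<sigma> S] by auto
  next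
    case (5 \<phi>)
    show ?case by (intro prod.cong) auto
  qed
  finally show ?thesis .
qed

section \<open>The double centralizer property\<close>

text \<open>A subspace has a linear retraction. It is arbitrary and need not respect any group;
  equivariance is produced afterwards by averaging. The \<open>D i\<close> may be dependent, so the
  coefficients are only asserted to exist.\<close>

lemma projection_onto_span:
  fixes D :: "'i \<Rightarrow> 'p \<Rightarrow> 'k::field"
  shows "\<exists>g. Vector_Spaces.linear (\<lambda>c f x. c * f x) (\<lambda>c f x. c * f x) g
    \<and> (\<forall>f. \<exists>l. g f = (\<lambda>x. \<Sum>i\<in>I. l i * D i x))
    \<and> (\<forall>l. g (\<lambda>x. \<Sum>i\<in>I. l i * D i x) = (\<lambda>x. \<Sum>i\<in>I. l i * D i x))"
proof -
  let ?s = "\<lambda>(c::'k) (f::'p \<Rightarrow> 'k) x. c * f x"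
  interpret vector_space ?s
    by standard (auto simp: fun_eq_iff algebra_simps)
  interpret vector_space_pair ?s ?s ..
  let ?A = "range (\<lambda>l x. \<Sum>i\<in>I. l i * D i x)"
  have A: "subspace ?A"
  proof (rule subspaceI)
    show "0 \<in> ?A" by (rule range_eqI[of _ _ "\<lambda>_. 0"]) (auto simp: fun_eq_iff)
    fix f assume "f \<in> ?A"
    then obtain l where l: "f = (\<lambda>x. \<Sum>i\<in>I. l i * D i x)" by auto
    show "?s c f \<in> ?A" for c
      by (rule range_eqI[of _ _ "\<lambda>i. c * l i"]) (auto simp: l sum_distrib_left mult.assoc)
    fix f' assume "f' \<in> ?A"
    then obtain l' where l': "f' = (\<lambda>x. \<Sum>i\<in>I. l' i * D i x)" by auto
    show "f + f' \<in> ?A"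
      by (rule range_eqI[of _ _ "\<lambda>i. l i + l' i"])
        (auto simp: l l' fun_eq_iff sum.distrib[symmetric] algebra_simps)
  qed
  obtain g where g: "g ` UNIV \<subseteq> ?A" "Vector_Spaces.linear ?s ?s g" "\<forall>v\<in>?A. g v = v"
    using linear_exists_left_inverse_on[OF linear_id A] by auto
  show ?thesis
    using g by (intro exI[of _ g]) blast
qed

lemma linear_fun_sum:
  fixes g :: "('p \<Rightarrow> 'k::field) \<Rightarrow> ('q \<Rightarrow> 'k)"
  assumes "Vector_Spaces.linear (\<lambda>c f x. c * f x) (\<lambda>c f x. c * f x) g"
  shows "g (\<lambda>x. \<Sum>i\<in>I. c i * f i x) p = (\<Sum>i\<in>I. c i * g (f i) p)"
proof -
  interpret g: Vector_Spaces.linear "\<lambda>c f x. c * f x" "\<lambda>c f x. c * f x" g by (rule assms)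
  have app: "(\<Sum>i\<in>I. h i) x = (\<Sum>i\<in>I. h i x)" for h :: "'i \<Rightarrow> 'r \<Rightarrow> 'k" and x and I
    by (induction I rule: infinite_finite_induct) auto
  have "(\<lambda>x. \<Sum>i\<in>I. c i * f i x) = (\<Sum>i\<in>I. (\<lambda>x. c i * f i x))"
    by (simp add: fun_eq_iff app)
  then have "g (\<lambda>x. \<Sum>i\<in>I. c i * f i x) = (\<Sum>i\<in>I. g (\<lambda>x. c i * f i x))"
    by (simp add: g.sum)
  then show ?thesis by (simp add: app g.scale)
qed

text \<open>The averaged projection \<open>N\<close> of all matrices onto the span of the permutation matrices is built
  from invariant matrices, so it commutes with \<open>T\<close>; evaluating it at the identity and at \<open>T\<close>
  puts \<open>T\<close> into the span.\<close>

lemma double_centralizer_permutation_action: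
  fixes T :: "'o \<Rightarrow> 'o \<Rightarrow> 'k::field_char_0" and act :: "'g \<Rightarrow> 'o \<Rightarrow> 'o"
  assumes fin: "finite X" "finite G" "G \<noteq> {}"
    and bij: "\<And>h. h \<in> G \<Longrightarrow> bij_betw (act h) X X"
    and quot: "\<And>h h'. h \<in> G \<Longrightarrow> h' \<in> G \<Longrightarrow>
      \<exists>h''\<in>G. \<forall>u\<in>X. \<forall>w\<in>X. act h u = act h' w \<longleftrightarrow> u = act h'' w"
    and translate: "\<And>h'. h' \<in> G \<Longrightarrow>
      \<exists>\<pi>. bij_betw \<pi> G G \<and> (\<forall>h\<in>G. \<forall>u\<in>X. act h (act h' u) = act (\<pi> h) u)"
    and comm: "\<And>N u w. (\<And>h u w. h \<in> G \<Longrightarrow> u \<in> X \<Longrightarrow> w \<in> X \<Longrightarrow> N (act h u) (act h w) = N u w)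
      \<Longrightarrow> u \<in> X \<Longrightarrow> w \<in> X \<Longrightarrow> (\<Sum>v\<in>X. T u v * N v w) = (\<Sum>v\<in>X. N u v * T v w)"
  shows "\<exists>l. \<forall>u\<in>X. \<forall>w\<in>X. T u w = (\<Sum>h\<in>G. l h * (if u = act h w then 1 else 0))"
proof -
  define D :: "'g \<Rightarrow> 'o \<times> 'o \<Rightarrow> 'k" where
    "D h = (\<lambda>(u, w). if u \<in> X \<and> w \<in> X \<and> u = act h w then 1 else 0)" for h
  define e :: "'o \<Rightarrow> 'o \<Rightarrow> 'o \<times> 'o \<Rightarrow> 'k" where
    "e v w = (\<lambda>p. if p = (v, w) then 1 else 0)" for v w
  let ?s = "\<lambda>(c::'k) (f::'o \<times> 'o \<Rightarrow> 'k) x. c * f x"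
  obtain g where lin: "Vector_Spaces.linear ?s ?s g"
    and g1: "\<And>f. \<exists>l. g f = (\<lambda>x. \<Sum>i\<in>G. l i * D i x)"
    and g2: "\<And>l. g (\<lambda>x. \<Sum>i\<in>G. l i * D i x) = (\<lambda>x. \<Sum>i\<in>G. l i * D i x)"
    using projection_onto_span[where I = G and D = D] by blast
  note gsum = linear_fun_sum[OF lin]
  \<comment> \<open>Let h move the row index of a matrix. Averaging \<open>g\<close> over
    conjugation by these moves gives a map whose value on the matrix unit at (u', w') has (u, w)
    entry \<open>N w w' u u'\<close> divided by \<open>card G\<close>. For fixed columns w and w'
    this block is an invariant matrix in u and u'.\<close>
  define N where "N w w' u u' = (\<Sum>h\<in>G. g (e (act h u') w') (act h u, w))" for w w' u u'
  have inv: "N w w' (act h' u) (act h' u') = N w w' u u'"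
    if "h' \<in> G" "u \<in> X" "u' \<in> X" for w w' h' u u'
  proof -
    obtain \<pi> where \<pi>: "bij_betw \<pi> G G" "\<And>h u. h\<in>G \<Longrightarrow> u\<in>X \<Longrightarrow> act h (act h' u) = act (\<pi> h) u"
      using translate[OF \<open>h' \<in> G\<close>] by blast
    have "N w w' (act h' u) (act h' u') = (\<Sum>h\<in>G. g (e (act (\<pi> h) u') w') (act (\<pi> h) u, w))"
      unfolding N_def by (intro sum.cong refl) (simp add: \<pi> that)
    also have "\<dots> = N w w' u u'"
      unfolding N_def using sum.reindex_bij_betw[OF \<pi>(1), of "\<lambda>h. g (e (act h u') w') (act h u, w)"] by simp
    finally show ?thesis .
  qed
  have mem: "act h u \<in> X" if "h \<in> G" "u \<in> X" for h u
    using bij[OF that(1)] that(2) by (auto simp: bij_betw_def)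
  have gD: "g (D h) = D h" if "h \<in> G" for h
  proof -
    have "D h = (\<lambda>x. \<Sum>i\<in>G. (if i = h then 1 else 0) * D i x)"
      using that fin by (simp add: if_distrib[of "\<lambda>a. a * _"] sum.delta cong: if_cong)
    then show ?thesis using g2 by metis
  qed
  \<comment> \<open>The averaged map fixes the identity matrix: moving its rows by h yields
    \<open>D h\<close>, which \<open>g\<close> fixes, and the move is then undone.\<close>
  have N_one: "(\<Sum>w'\<in>X. N w w' u w') = of_nat (card G) * (if u = w then 1 else 0)"
    if "u \<in> X" "w \<in> X" for u w
  proof -
    have "(\<Sum>w'\<in>X. N w w' u w') = (\<Sum>h\<in>G. \<Sum>w'\<in>X. g (e (act h w') w') (act h u, w))"
      unfolding N_def by (rule sum.swap)
    also have "\<dots> = (\<Sum>h\<in>G. if u = w then 1 else 0)"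
    proof (intro sum.cong refl)
      fix h assume h: "h \<in> G"
      have "(\<lambda>x. \<Sum>w'\<in>X. 1 * e (act h w') w' x) = D h"
      proof
        fix x :: "'o \<times> 'o"
        obtain a b where x: "x = (a, b)" by force
        have "(\<Sum>w'\<in>X. 1 * e (act h w') w' x)
            = (\<Sum>w'\<in>X. if w' = b then (if a = act h w' then 1 else 0) else 0)"
          by (intro sum.cong) (auto simp: e_def x)
        also have "\<dots> = D h x" using fin mem[OF h] by (auto simp: D_def x)
        finally show "(\<Sum>w'\<in>X. 1 * e (act h w') w' x) = D h x" .
      qed
      then have "(\<Sum>w'\<in>X. g (e (act h w') w') (act h u, w)) = g (D h) (act h u, w)"
        using gsum[where I = X and c = "\<lambda>_. 1" and f = "\<lambda>w'. e (act h w') w'"] by simp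
      also have "\<dots> = (if u = w then 1 else 0)"
        using mem[OF h] that bij_betw_imp_inj_on[OF bij[OF h]]
        unfolding gD[OF h] by (auto simp: D_def inj_on_def)
      finally show "(\<Sum>w'\<in>X. g (e (act h w') w') (act h u, w)) = (if u = w then 1 else 0)" .
    qed
    finally show ?thesis by simp
  qed
  \<comment> \<open>This is T with its rows moved by h: the entry at (\<open>act h v\<close>, w') is
    \<open>T v w'\<close>.\<close>
  define XT where "XT h = (\<lambda>x. \<Sum>p\<in>X \<times> X. T (fst p) (snd p) * e (act h (fst p)) (snd p) x)" for h
  have key: "of_nat (card G) * T u w = (\<Sum>h\<in>G. g (XT h) (act h u, w))" if "u \<in> X" "w \<in> X" for u w
  proof -
    have "(\<Sum>h\<in>G. g (XT h) (act h u, w))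
       = (\<Sum>h\<in>G. \<Sum>p\<in>X\<times>X. T (fst p) (snd p) * g (e (act h (fst p)) (snd p)) (act h u, w))"
      unfolding XT_def by (simp only: gsum)
    also have "\<dots> = (\<Sum>p\<in>X\<times>X. N w (snd p) u (fst p) * T (fst p) (snd p))"
      unfolding N_def by (subst sum.swap) (simp add: sum_distrib_left mult.commute)
    also have "\<dots> = (\<Sum>v\<in>X. \<Sum>w'\<in>X. N w w' u v * T v w')"
      by (simp add: sum.cartesian_product case_prod_beta)
    also have "\<dots> = (\<Sum>w'\<in>X. \<Sum>v\<in>X. N w w' u v * T v w')"
      by (rule sum.swap)
    \<comment> \<open>For fixed w and w' the hypothesis \<open>comm\<close> applies to the block
      \<open>N w w'\<close>. It pulls T out in front, leaving the averaged image of the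
      identity.\<close>
    also have "\<dots> = (\<Sum>w'\<in>X. \<Sum>v\<in>X. T u v * N w w' v w')"
      by (intro sum.cong refl comm[symmetric] inv that) auto
    also have "\<dots> = (\<Sum>v\<in>X. T u v * (\<Sum>w'\<in>X. N w w' v w'))"
      by (subst sum.swap) (simp add: sum_distrib_left)
    also have "\<dots> = (\<Sum>v\<in>X. T u v * (of_nat (card G) * (if v = w then 1 else 0)))"
      by (intro sum.cong refl) (simp add: N_one that)
    also have "\<dots> = of_nat (card G) * T u w"
      using fin that by (simp add: if_distrib[of "\<lambda>a. _ * a"] sum.delta mult.commute cong: if_cong)
    finally show ?thesis by simp
  qed
  have "\<forall>h. \<exists>l. g (XT h) = (\<lambda>x. \<Sum>i\<in>G. l i * D i x)" using g1 by blast
  from choice[OF this] obtain L where L: "g (XT h) = (\<lambda>x. \<Sum>i\<in>G. L h i * D i x)" for h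
    by blast
  define q where "q h h' = (SOME k. k \<in> G \<and>
    (\<forall>u\<in>X. \<forall>w\<in>X. act h u = act h' w \<longleftrightarrow> u = act k w))" for h h'
  have q: "q h h' \<in> G \<and> (\<forall>u\<in>X. \<forall>w\<in>X. act h u = act h' w \<longleftrightarrow> u = act (q h h') w)"
    if "h \<in> G" "h' \<in> G" for h h'
    unfolding q_def by (rule someI_ex) (use quot[OF that] in blast)
  \<comment> \<open>Undoing the row move h turns the permutation matrix \<open>D i\<close> into that
    of \<open>q h i\<close>; \<open>l k\<close> collects all pairs with the same result.\<close>
  define l where "l k = (\<Sum>h\<in>G. \<Sum>i\<in>G. if q h i = k then L h i else 0) / of_nat (card G)" for k
  have card: "of_nat (card G) \<noteq> (0::'k)" using fin by auto
  have l: "of_nat (card G) * l k = (\<Sum>h\<in>G. \<Sum>i\<in>G. if q h i = k then L h i else 0)" for k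
    using card by (simp add: l_def)
  have "T u w = (\<Sum>k\<in>G. l k * (if u = act k w then 1 else 0))" if "u \<in> X" "w \<in> X" for u w
  proof -
    have "of_nat (card G) * T u w = (\<Sum>h\<in>G. \<Sum>i\<in>G. L h i * D i (act h u, w))"
      using key[OF that] by (simp add: L)
    also have "\<dots> = (\<Sum>h\<in>G. \<Sum>i\<in>G. \<Sum>k\<in>G. if q h i = k then L h i * (if u = act k w then 1 else 0) else 0)"
      using q fin mem that by (intro sum.cong refl) (simp add: D_def)
    also have "\<dots> = (\<Sum>k\<in>G. \<Sum>h\<in>G. \<Sum>i\<in>G. if q h i = k then L h i * (if u = act k w then 1 else 0) else 0)"
      by (rule trans[OF sum.cong[OF refl sum.swap] sum.swap])
    also have "\<dots> = (\<Sum>k\<in>G. of_nat (card G) * (l k * (if u = act k w then 1 else 0)))"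
      by (intro sum.cong refl, subst mult.assoc[symmetric], subst l, unfold sum_distrib_right)
        (intro sum.cong refl, simp)
    also have "\<dots> = of_nat (card G) * (\<Sum>k\<in>G. l k * (if u = act k w then 1 else 0))"
      by (simp add: sum_distrib_left)
    finally show ?thesis using card by simp
  qed
  then show ?thesis by blast
qed

section \<open>The commutant of the tensor powers\<close>

lemma bij_betw_comp_permutes_PiE:
  assumes "\<sigma> permutes S"
  shows "bij_betw (\<lambda>a. a \<circ> \<sigma>) (S \<rightarrow>\<^sub>E A) (S \<rightarrow>\<^sub>E A)"
proof -
  have mem: "a \<circ> \<rho> \<in> S \<rightarrow>\<^sub>E A" if "a \<in> S \<rightarrow>\<^sub>E A" "\<rho> permutes S" for a \<rho>
    using that permutes_in_image[OF that(2)] by (auto simp: PiE_iff extensional_def permutes_not_in)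
  show ?thesis
    using permutes_inv_o[OF assms] mem[OF _ assms] mem[OF _ permutes_inv[OF assms]]
    by (intro bij_betw_byWitness[where f' = "\<lambda>a. a \<circ> inv \<sigma>"])
      (simp_all add: o_assoc[symmetric] image_subset_iff)
qed

text \<open>The pair (a, e) labels a basis vector of the tensor power of k^n tensored with that of
  k^m, and the permutations permute its places. Precomposition is a right action, so composites
  appear in reversed order.\<close>

definition permute_pair :: "('s \<Rightarrow> 's) \<times> ('s \<Rightarrow> 's) \<Rightarrow> ('s \<Rightarrow> 'n) \<times> ('s \<Rightarrow> 'm) \<Rightarrow> ('s \<Rightarrow> 'n) \<times> ('s \<Rightarrow> 'm)" where
  "permute_pair = (\<lambda>(\<sigma>, \<tau>) (a, e). (a \<circ> \<sigma>, e \<circ> \<tau>))"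

text \<open>The sum over t in T of the matrix units at (p t, q t).\<close>

definition match_matrix :: "('s \<Rightarrow> 'n) \<Rightarrow> ('s \<Rightarrow> 'n) \<Rightarrow> 's set \<Rightarrow> 'n \<Rightarrow> 'n \<Rightarrow> 'k::comm_ring_1" where
  "match_matrix p q T a b = (\<Sum>t\<in>T. if p t = a \<and> q t = b then 1 else 0)"

text \<open>The left side is the entry at (u, w) of the orbit sum of the matrix unit at (p, q) under
  place permutations. Each summand is a product over places, so the whole is a permanent, and
  Ryser's formula writes it through tensor powers of \<open>match_matrix p q T\<close>.
  Extensionality makes agreement on S equality of functions.\<close>

lemma sum_permutes_match_tensor_power:
  fixes p q u w :: "'s \<Rightarrow> 'n"
  assumes S: "finite S" and ext: "p \<in> S \<rightarrow>\<^sub>E UNIV" "q \<in> S \<rightarrow>\<^sub>E UNIV" "u \<in> S \<rightarrow>\<^sub>E UNIV" "w \<in> S \<rightarrow>\<^sub>E UNIV"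
  shows "(\<Sum>\<sigma> | \<sigma> permutes S. if p \<circ> \<sigma> = u \<and> q \<circ> \<sigma> = w then 1 else (0::'k::comm_ring_1))
    = (\<Sum>T\<in>Pow S. (-1) ^ (card S - card T)
        * (\<Prod>t\<in>S. match_matrix p q T (u t) (w t)))"
proof -
  have "(\<Prod>t\<in>S. if p (\<sigma> t) = u t \<and> q (\<sigma> t) = w t then 1 else 0)
      = (if p \<circ> \<sigma> = u \<and> q \<circ> \<sigma> = w then 1 else (0::'k))" if \<sigma>: "\<sigma> permutes S" for \<sigma>
  proof (cases "\<forall>t\<in>S. p (\<sigma> t) = u t \<and> q (\<sigma> t) = w t")
    case True
    have "(p \<circ> \<sigma>) t = u t \<and> (q \<circ> \<sigma>) t = w t" for t
      using True ext \<sigma> by (cases "t \<in> S") (auto simp: permutes_not_in PiE_iff extensional_def)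
    then show ?thesis using True by (auto simp: fun_eq_iff intro!: prod.neutral)
  next
    case False
    then obtain t where t: "t \<in> S" "\<not> (p (\<sigma> t) = u t \<and> q (\<sigma> t) = w t)" by blast
    then have "\<not> (p \<circ> \<sigma> = u \<and> q \<circ> \<sigma> = w)" by auto
    then show ?thesis using t S by (subst prod_zero) auto
  qed
  then show ?thesis
    using alternating_sum_prod_eq_sum_permutes
      [OF S, of "\<lambda>t' t. if p t' = u t \<and> q t' = w t then 1 else (0::'k)"]
    by (simp add: match_matrix_def)
qed

text \<open>The hypothesis ranges over arbitrary \<open>g1\<close> and \<open>g2\<close> because it
  is applied to match matrices, which are usually singular.\<close>

lemma commutant_tensor_powers:
  fixes T :: "('s \<Rightarrow> 'n::finite) \<times> ('s \<Rightarrow> 'm::finite) \<Rightarrow> ('s \<Rightarrow> 'n) \<times> ('s \<Rightarrow> 'm) \<Rightarrow> 'k::field_char_0"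
  assumes S: "finite S"
  defines "X \<equiv> (S \<rightarrow>\<^sub>E UNIV) \<times> (S \<rightarrow>\<^sub>E UNIV)"
  defines "G \<equiv> {\<sigma>. \<sigma> permutes S} \<times> {\<tau>. \<tau> permutes S}"
  assumes comm: "\<And>g1 g2 u w. u \<in> X \<Longrightarrow> w \<in> X \<Longrightarrow>
    (\<Sum>v\<in>X. T u v * ((\<Prod>t\<in>S. g1 (fst v t) (fst w t)) * (\<Prod>t\<in>S. g2 (snd v t) (snd w t))))
    = (\<Sum>v\<in>X. ((\<Prod>t\<in>S. g1 (fst u t) (fst v t)) * (\<Prod>t\<in>S. g2 (snd u t) (snd v t))) * T v w)"
  shows "\<exists>l. \<forall>u\<in>X. \<forall>w\<in>X. T u w = (\<Sum>h\<in>G. l h * (if u = permute_pair h w then 1 else 0))"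
proof (rule double_centralizer_permutation_action)
  show finX: "finite X" unfolding X_def using S by (intro finite_cartesian_product finite_PiE) auto
  show finG: "finite G" unfolding G_def using S by (intro finite_cartesian_product finite_permutations)
  show neG: "G \<noteq> {}" unfolding G_def using permutes_id by blast
  show bij: "bij_betw (permute_pair h) X X" if h: "h \<in> G" for h
  proof -
    obtain \<sigma> \<tau> where h': "h = (\<sigma>, \<tau>)" "\<sigma> permutes S" "\<tau> permutes S" using h by (auto simp: G_def)
    show ?thesis
      unfolding X_def h' permute_pair_def prod.case
      using bij_betw_map_prod[OF bij_betw_comp_permutes_PiE[OF h'(2)] bij_betw_comp_permutes_PiE[OF h'(3)]]
      by (simp add: map_prod_def)
  qed
  show "\<exists>h''\<in>G. \<forall>u\<in>X. \<forall>w\<in>X. permute_pair h u = permute_pair h' w \<longleftrightarrow> u = permute_pair h'' w"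
    if hh: "h \<in> G" "h' \<in> G" for h h'
  proof -
    obtain \<sigma> \<tau> where h: "h = (\<sigma>, \<tau>)" "\<sigma> permutes S" "\<tau> permutes S" using hh by (auto simp: G_def)
    obtain \<sigma>' \<tau>' where h': "h' = (\<sigma>', \<tau>')" "\<sigma>' permutes S" "\<tau>' permutes S" using hh by (auto simp: G_def)
    have eq: "a \<circ> \<rho> = b \<circ> \<rho>' \<longleftrightarrow> a = b \<circ> (\<rho>' \<circ> inv \<rho>)" if "\<rho> permutes S" for a b :: "'s \<Rightarrow> 'c" and \<rho> \<rho>'
    proof
      assume "a \<circ> \<rho> = b \<circ> \<rho>'"
      then have "a \<circ> \<rho> \<circ> inv \<rho> = b \<circ> \<rho>' \<circ> inv \<rho>" by simp
      then show "a = b \<circ> (\<rho>' \<circ> inv \<rho>)"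
        using permutes_inv_o(1)[OF that] by (simp add: o_assoc[symmetric])
    next
      assume "a = b \<circ> (\<rho>' \<circ> inv \<rho>)"
      then show "a \<circ> \<rho> = b \<circ> \<rho>'"
        using permutes_inv_o(2)[OF that] by (simp add: o_assoc[symmetric])
    qed
    show ?thesis
      using h h' permutes_compose[OF permutes_inv[OF h(2)] h'(2)] permutes_compose[OF permutes_inv[OF h(3)] h'(3)]
      by (intro bexI[of _ "(\<sigma>' \<circ> inv \<sigma>, \<tau>' \<circ> inv \<tau>)"])
        (auto simp: permute_pair_def G_def eq)
  qed
  show "\<exists>\<pi>. bij_betw \<pi> G G \<and> (\<forall>h\<in>G. \<forall>u\<in>X. permute_pair h (permute_pair h' u) = permute_pair (\<pi> h) u)"
    if h: "h' \<in> G" for h'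
  proof -
    obtain \<sigma>' \<tau>' where h': "h' = (\<sigma>', \<tau>')" "\<sigma>' permutes S" "\<tau>' permutes S" using h by (auto simp: G_def)
    have b: "bij_betw (\<lambda>\<sigma>. \<rho> \<circ> \<sigma>) {\<sigma>. \<sigma> permutes S} {\<sigma>. \<sigma> permutes S}" if "\<rho> permutes S" for \<rho>
      using that permutes_inv[OF that] permutes_inv_o[OF that]
      by (intro bij_betw_byWitness[where f' = "\<lambda>\<sigma>. inv \<rho> \<circ> \<sigma>"]) (auto simp: o_assoc intro: permutes_compose)
    show ?thesis
      using bij_betw_map_prod[OF b[OF h'(2)] b[OF h'(3)]] 
      by (intro exI[of _ "map_prod (\<lambda>\<sigma>. \<sigma>' \<circ> \<sigma>) (\<lambda>\<tau>. \<tau>' \<circ> \<tau>)"])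
        (auto simp: G_def h' permute_pair_def o_assoc)
  qed
  fix N :: "('s \<Rightarrow> 'n) \<times> ('s \<Rightarrow> 'm) \<Rightarrow> ('s \<Rightarrow> 'n) \<times> ('s \<Rightarrow> 'm) \<Rightarrow> 'k" and u w
  assume inv: "\<And>h u w. h \<in> G \<Longrightarrow> u \<in> X \<Longrightarrow> w \<in> X \<Longrightarrow> N (permute_pair h u) (permute_pair h w) = N u w"
  assume u: "u \<in> X" and w: "w \<in> X"
  define C where "C M \<longleftrightarrow> (\<forall>u\<in>X. \<forall>w\<in>X. (\<Sum>v\<in>X. T u v * M v w) = (\<Sum>v\<in>X. M u v * T v w))" for M
  have C_sum: "C (\<lambda>u w. \<Sum>i\<in>I. c i * M i u w)" if "\<And>i. i \<in> I \<Longrightarrow> C (M i)" for I :: "'i set" and c M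
    unfolding C_def
  proof (intro ballI)
    fix u w assume u: "u \<in> X" and w: "w \<in> X"
    have "(\<Sum>v\<in>X. T u v * (\<Sum>i\<in>I. c i * M i v w)) = (\<Sum>i\<in>I. c i * (\<Sum>v\<in>X. T u v * M i v w))"
      by (simp add: sum_distrib_left mult.left_commute) (rule sum.swap)
    also have "\<dots> = (\<Sum>i\<in>I. c i * (\<Sum>v\<in>X. M i u v * T v w))"
      using that u w by (intro sum.cong refl) (simp add: C_def)
    also have "\<dots> = (\<Sum>v\<in>X. (\<Sum>i\<in>I. c i * M i u v) * T v w)"
      by (simp add: sum_distrib_left sum_distrib_right mult.assoc) (rule sum.swap)
    finally show "(\<Sum>v\<in>X. T u v * (\<Sum>i\<in>I. c i * M i v w)) = (\<Sum>v\<in>X. (\<Sum>i\<in>I. c i * M i u v) * T v w)" .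
  qed
  have C_cong: "C M'" if "C M" "\<And>u w. u \<in> X \<Longrightarrow> w \<in> X \<Longrightarrow> M' u w = M u w" for M M'
    using that by (simp add: C_def)
  \<comment> \<open>The orbit sum of the matrix unit at (p, q), in which every orbit element is
    counted as often as the stabilizer has elements.\<close>
  define O' where "O' p q u w = (\<Sum>h\<in>G. if permute_pair h p = u \<and> permute_pair h q = w then 1 else (0::'k))"
    for p q u w :: "('s \<Rightarrow> 'n) \<times> ('s \<Rightarrow> 'm)"
  have C_O: "C (O' p q)" if p: "p \<in> X" and q: "q \<in> X" for p q
  proof -
    note m = sum_permutes_match_tensor_power[OF S, where ?'k = 'k]
    let ?P = "Pow S \<times> Pow S"
    let ?M = "\<lambda>(T, T') v w. (\<Prod>t\<in>S. match_matrix (fst p) (fst q) T (fst v t) (fst w t)) *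
              (\<Prod>t\<in>S. match_matrix (snd p) (snd q) T' (snd v t) (snd w t))"
    have "C (\<lambda>u w. \<Sum>z\<in>?P. ((-1) ^ (card S - card (fst z)) * (-1) ^ (card S - card (snd z))) * ?M z u w)"
      by (rule C_sum) (simp add: C_def case_prod_beta comm)
    then show ?thesis
    proof (rule C_cong)
      fix u w assume u: "u \<in> X" and w: "w \<in> X"
      have "O' p q u w = (\<Sum>\<sigma> | \<sigma> permutes S. \<Sum>\<tau> | \<tau> permutes S.
          (if fst p \<circ> \<sigma> = fst u \<and> fst q \<circ> \<sigma> = fst w then 1 else 0) *
          (if snd p \<circ> \<tau> = snd u \<and> snd q \<circ> \<tau> = snd w then 1 else 0))"
        unfolding O'_def G_def sum.cartesian_product
        by (intro sum.cong refl) (auto simp: permute_pair_def case_prod_beta prod_eq_iff)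
      also have "\<dots> = (\<Sum>\<sigma> | \<sigma> permutes S. if fst p \<circ> \<sigma> = fst u \<and> fst q \<circ> \<sigma> = fst w then 1 else 0) *
          (\<Sum>\<tau> | \<tau> permutes S. if snd p \<circ> \<tau> = snd u \<and> snd q \<circ> \<tau> = snd w then 1 else 0)"
        by (simp only: sum_product)
      also have "\<dots> = (\<Sum>T\<in>Pow S. (-1) ^ (card S - card T) * (\<Prod>t\<in>S. match_matrix (fst p) (fst q) T (fst u t) (fst w t))) *
         (\<Sum>T\<in>Pow S. (-1) ^ (card S - card T) * (\<Prod>t\<in>S. match_matrix (snd p) (snd q) T (snd u t) (snd w t)))"
        using p q u w by (intro arg_cong2[where f = "(*)"] m) (auto simp: X_def)
      also have "\<dots> = (\<Sum>z\<in>?P. ((-1) ^ (card S - card (fst z)) * (-1) ^ (card S - card (snd z))) * ?M z u w)"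
        unfolding sum_product sum.cartesian_product
        by (intro sum.cong refl) (simp add: case_prod_beta mult_ac)
      finally show "O' p q u w = \<dots>" .
    qed
  qed
  \<comment> \<open>An invariant N is a combination of orbit sums with its own entries as
    coefficients. Each h carries exactly one pair (p, q) to a given (u, w), so that entry is counted
    \<open>card G\<close> times.\<close>
  have "C (\<lambda>u w. \<Sum>z\<in>X\<times>X. (N (fst z) (snd z) / of_nat (card G)) * O' (fst z) (snd z) u w)"
    by (rule C_sum) (auto intro: C_O)
  then have "C N"
  proof (rule C_cong)
    fix u w assume u: "u \<in> X" and w: "w \<in> X"
    have one: "(\<Sum>p\<in>X. if permute_pair h p = v then 1 else (0::'k)) = 1"
      if "h \<in> G" "v \<in> X" for h v
      using sum.reindex_bij_betw[OF bij[OF that(1)], of "\<lambda>p. if p = v then 1 else (0::'k)"] that finX by simp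
    have "(\<Sum>z\<in>X\<times>X. N (fst z) (snd z) * O' (fst z) (snd z) u w)
      = (\<Sum>h\<in>G. \<Sum>z\<in>X\<times>X. N (fst z) (snd z) *
          (if permute_pair h (fst z) = u \<and> permute_pair h (snd z) = w then 1 else 0))"
      unfolding O'_def sum_distrib_left by (rule sum.swap)
    also have "\<dots> = (\<Sum>h\<in>G. \<Sum>p\<in>X. \<Sum>q\<in>X. N u w *
          ((if permute_pair h p = u then 1 else 0) * (if permute_pair h q = w then 1 else 0)))"
      unfolding sum.cartesian_product
      by (intro sum.cong refl) (auto simp: inv[symmetric])
    also have "\<dots> = (\<Sum>h\<in>G. N u w * ((\<Sum>p\<in>X. if permute_pair h p = u then 1 else 0) *
          (\<Sum>q\<in>X. if permute_pair h q = w then 1 else 0)))"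
      by (simp only: sum_distrib_left[symmetric] sum_product)
    also have "\<dots> = of_nat (card G) * N u w"
      using u w by (simp add: one)
    finally have "(\<Sum>z\<in>X\<times>X. N (fst z) (snd z) * O' (fst z) (snd z) u w) = of_nat (card G) * N u w" .
    moreover have "of_nat (card G) \<noteq> (0::'k)" using finG neG by auto
    ultimately show "N u w = (\<Sum>z\<in>X\<times>X. (N (fst z) (snd z) / of_nat (card G)) * O' (fst z) (snd z) u w)"
      by (simp add: sum_divide_distrib[symmetric])
  qed
  then show "(\<Sum>v\<in>X. T u v * N v w) = (\<Sum>v\<in>X. N u v * T v w)"
    using u w by (simp add: C_def)
qed

section \<open>Words in the products of Q and R, and the easy inclusion\<close>

lemma alg_generated_sum:
  "(\<And>i. i \<in> I \<Longrightarrow> f i \<in> alg_generated S) \<Longrightarrow> (\<lambda>w. \<Sum>i\<in>I. f i w) \<in> alg_generated S"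
  by (induction I rule: infinite_finite_induct) (auto intro: alg_generated.intros)

lemma alg_generated_scale: "f \<in> alg_generated S \<Longrightarrow> (\<lambda>w. c * f w) \<in> alg_generated S"
  using alg_generated.mult[OF alg_generated.const] by blast

text \<open>Words before the trace closes them: a cycle of a permutation is assembled by
  concatenating open words.\<close>

definition word_matrix ::
  "('d \<times> 'd) list \<Rightarrow> ('k::field, 'n::finite, 'm::finite, 'd::finite) W \<Rightarrow> 'k^'n^'n" where
  "word_matrix ps = (\<lambda>(Q, R). foldr (**) (map (\<lambda>(i, j). Q $ i ** R $ j) ps) (mat 1))"

lemma trace_fun_eq: "trace_fun ps w = trace (word_matrix ps w)"
  by (simp add: trace_fun_def word_matrix_def case_prod_beta)

lemma word_matrix_Nil [simp]: "word_matrix [] w = mat 1"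
  by (simp add: word_matrix_def case_prod_beta)

lemma word_matrix_Cons: "word_matrix (p # ps) w = (fst w $ fst p ** snd w $ snd p) ** word_matrix ps w"
  by (simp add: word_matrix_def case_prod_beta)

lemma word_matrix_append: "word_matrix (ps @ qs) w = word_matrix ps w ** word_matrix qs w"
  by (induction ps) (simp_all add: word_matrix_Cons matrix_mul_assoc)

lemma matrix_inv_cancel:
  assumes "invertible (A :: 'a::semiring_1^'n^'m)"
  shows "A ** matrix_inv A = mat 1" "matrix_inv A ** A = mat 1"
  using someI_ex[OF assms[unfolded invertible_def]] by (simp_all add: matrix_inv_def)

lemma word_matrix_actW:
  assumes "invertible g1" "invertible g2"
  shows "word_matrix ps (actW (g1, g2) w) = g1 ** word_matrix ps w ** matrix_inv g1"
proof (induction ps)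
  case Nil
  then show ?case by (simp add: matrix_inv_cancel[OF assms(1)])
next
  case (Cons p ps)
  let ?Q = "fst w $ fst p" and ?R = "snd w $ snd p" and ?M = "word_matrix ps w"
  have "word_matrix (p # ps) (actW (g1, g2) w)
      = g1 ** ?Q ** (matrix_inv g2 ** g2) ** ?R ** (matrix_inv g1 ** g1) ** ?M ** matrix_inv g1"
    by (simp add: word_matrix_Cons Cons.IH) (simp add: actW_def case_prod_beta matrix_mul_assoc)
  then show ?case
    by (simp add: matrix_inv_cancel[OF assms(1)] matrix_inv_cancel[OF assms(2)]
        word_matrix_Cons matrix_mul_assoc)
qed

lemma trace_fun_actW:
  assumes "invertible g1" "invertible g2"
  shows "trace_fun ps (actW (g1, g2) w) = trace_fun ps w"
  using trace_mul_sym[of "g1 ** word_matrix ps w" "matrix_inv g1"]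
  by (simp add: trace_fun_eq word_matrix_actW[OF assms] matrix_mul_assoc matrix_inv_cancel[OF assms(1)])

lemma coordinate_polynomial:
  "(\<lambda>w. fst w $ i $ a $ b) \<in> polynomial_functions scaleW"
  "(\<lambda>w. snd w $ i $ b $ a) \<in> polynomial_functions scaleW"
  unfolding polynomial_functions_def
  by (auto intro!: alg_generated.base module_hom_linearI
      simp: Vector_Spaces.linear_iff vector_space_scaleW scaleW_def case_prod_beta)
    (simp_all add: vector_space_def algebra_simps)

lemma word_matrix_polynomial:
  "(\<lambda>w :: ('k::field, 'n::finite, 'm::finite, 'd::finite) W. word_matrix ps w $ a $ b) \<in> polynomial_functions scaleW"
proof (induction ps arbitrary: a b)
  case Nil
  show ?case by (simp add: polynomial_functions_def alg_generated.const)
next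
  case (Cons p ps)
  have "(\<lambda>w :: ('k, 'n, 'm, 'd) W. \<Sum>c\<in>UNIV. (\<Sum>e\<in>UNIV. fst w $ fst p $ a $ e * snd w $ snd p $ e $ c) * word_matrix ps w $ c $ b)
      \<in> polynomial_functions scaleW"
    using Cons coordinate_polynomial unfolding polynomial_functions_def
    by (intro alg_generated_sum alg_generated.mult)
  then show ?case by (simp add: word_matrix_Cons matrix_matrix_mult_def)
qed

lemma alg_generated_traces_subset_invariantsW:
  "alg_generated {trace_fun ps | ps. ps \<noteq> []}
    \<subseteq> (invariantsW :: (('k::field, 'n::finite, 'm::finite, 'd::finite) W \<Rightarrow> 'k) set)"
proof
  fix f :: "('k, 'n, 'm, 'd) W \<Rightarrow> 'k"
  assume "f \<in> alg_generated {trace_fun ps | ps. ps \<noteq> []}"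
  then show "f \<in> invariantsW"
  proof induction
    case (base f)
    then obtain ps where f: "f = trace_fun ps" by blast
    have "(\<lambda>w. \<Sum>a\<in>UNIV. word_matrix ps w $ a $ a) \<in> polynomial_functions scaleW"
      using word_matrix_polynomial unfolding polynomial_functions_def by (intro alg_generated_sum)
    then have "f \<in> polynomial_functions scaleW"
      by (simp add: f trace_fun_eq[abs_def] trace_def)
    then show ?case by (auto simp: invariantsW_def f GL_def trace_fun_actW)
  qed (auto simp: invariantsW_def polynomial_functions_def intro: alg_generated.intros)
qed

section \<open>Contractions along a permutation\<close>

lemma sum_PiE_insert:
  assumes "x \<notin> S"
  shows "(\<Sum>a\<in>insert x S \<rightarrow>\<^sub>E A. F a) = (\<Sum>a\<in>S \<rightarrow>\<^sub>E A. \<Sum>y\<in>A. F (a(x := y)))"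
proof -
  have "(\<Sum>a\<in>insert x S \<rightarrow>\<^sub>E A. F a) = (\<Sum>(y, a)\<in>A \<times> (S \<rightarrow>\<^sub>E A). F (a(x := y)))"
    unfolding PiE_insert_eq
    by (subst sum.reindex[OF inj_combinator[OF assms]]) (simp add: case_prod_beta o_def)
  also have "\<dots> = (\<Sum>y\<in>A. \<Sum>a\<in>S \<rightarrow>\<^sub>E A. F (a(x := y)))"
    by (simp add: sum.cartesian_product)
  finally show ?thesis by (simp add: sum.swap[of _ A])
qed

text \<open>Removing \<open>x\<close> from its cycle splits off a trace if \<open>x\<close> is fixed, and otherwise appends its word
  to the word at the preceding slot.\<close>

lemma cyclic_contraction_mem_traces:
  fixes L :: "'s \<Rightarrow> ('d::finite \<times> 'd) list"
  assumes "finite S" "\<sigma> permutes S" "\<forall>t\<in>S. L t \<noteq> []"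
  shows "(\<lambda>w. \<Sum>a\<in>S \<rightarrow>\<^sub>E UNIV. \<Prod>t\<in>S. word_matrix (L t) w $ a t $ a (\<sigma> t))
    \<in> alg_generated {trace_fun ps :: ('k::field, 'n::finite, 'm::finite, 'd) W \<Rightarrow> 'k | ps. ps \<noteq> []}"
  using assms
proof (induction S arbitrary: \<sigma> L rule: finite_induct)
  case empty
  then show ?case by (simp add: alg_generated.const)
next
  case (insert x S)
  note \<sigma> = \<open>\<sigma> permutes insert x S\<close>
  have expand: "(\<Sum>a\<in>insert x S \<rightarrow>\<^sub>E UNIV. \<Prod>t\<in>insert x S. word_matrix (L t) w $ a t $ a (\<sigma> t))
    = (\<Sum>a\<in>S \<rightarrow>\<^sub>E UNIV. \<Sum>y\<in>UNIV. word_matrix (L x) w $ y $ ((a(x := y)) (\<sigma> x))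
        * (\<Prod>t\<in>S. word_matrix (L t) w $ a t $ ((a(x := y)) (\<sigma> t))))" for w :: "('k, 'n, 'm, 'd) W"
    unfolding sum_PiE_insert[OF \<open>x \<notin> S\<close>] using insert.hyps
    by (intro sum.cong refl) (auto intro!: prod.cong)
  show ?case
  proof (cases "\<sigma> x = x")
    case True
    then have perm: "\<sigma> permutes S" using permutes_insert_lemma[OF \<sigma>] by simp
    have ne: "\<sigma> t \<noteq> x" if "t \<in> S" for t
      using permutes_in_image[OF perm] that insert.hyps by metis
    have "(\<Sum>a\<in>insert x S \<rightarrow>\<^sub>E UNIV. \<Prod>t\<in>insert x S. word_matrix (L t) w $ a t $ a (\<sigma> t))
      = trace_fun (L x) w * (\<Sum>a\<in>S \<rightarrow>\<^sub>E UNIV. \<Prod>t\<in>S. word_matrix (L t) w $ a t $ a (\<sigma> t))"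
      for w :: "('k, 'n, 'm, 'd) W"
      unfolding expand trace_fun_eq trace_def sum_product
      by (subst sum.swap, intro sum.cong refl) (simp add: True ne)
    moreover have "(\<lambda>w. \<Sum>a\<in>S \<rightarrow>\<^sub>E UNIV. \<Prod>t\<in>S. word_matrix (L t) w $ a t $ a (\<sigma> t))
      \<in> alg_generated {trace_fun ps :: ('k, 'n, 'm, 'd) W \<Rightarrow> 'k | ps. ps \<noteq> []}"
      using insert.IH[OF perm] insert.prems by auto
    moreover have "trace_fun (L x) \<in> alg_generated {trace_fun ps :: ('k, 'n, 'm, 'd) W \<Rightarrow> 'k | ps. ps \<noteq> []}"
      using insert.prems by (auto intro: alg_generated.base)
    ultimately show ?thesis by (simp only: alg_generated.mult)
  next
    case False
    \<comment> \<open>The transposition bypasses x: its predecessor s is now sent to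
      \<open>\<sigma> x\<close>, x becomes fixed, and all other values are unchanged.\<close>
    define \<sigma>' where "\<sigma>' = Transposition.transpose x (\<sigma> x) \<circ> \<sigma>"
    have perm: "\<sigma>' permutes S" unfolding \<sigma>'_def by (rule permutes_insert_lemma[OF \<sigma>])
    define s where "s = inv \<sigma> x"
    have \<sigma>s: "\<sigma> s = x" unfolding s_def using \<sigma> by (simp add: permutes_inverses)
    have s: "s \<in> S" "s \<noteq> x"
    proof -
      show "s \<noteq> x" using \<sigma>s False by auto
      then show "s \<in> S" using \<sigma>s permutes_not_in[OF \<sigma>, of s] by auto
    qed
    have \<sigma>x: "\<sigma> x \<in> S" using permutes_in_image[OF \<sigma>, of x] False by auto
    have other: "\<sigma> t \<noteq> x \<and> \<sigma>' t = \<sigma> t" if "t \<in> S" "t \<noteq> s" for t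
    proof -
      have "\<sigma> t \<noteq> x" using that \<sigma>s permutes_inj[OF \<sigma>] by (metis injD)
      moreover have "\<sigma> t \<noteq> \<sigma> x" using that insert.hyps permutes_inj[OF \<sigma>] by (metis injD)
      ultimately show ?thesis by (simp add: \<sigma>'_def)
    qed
    have \<sigma>'s: "\<sigma>' s = \<sigma> x" by (simp add: \<sigma>'_def \<sigma>s)
    \<comment> \<open>The index y at x occurs only as column of the word at s and as row of the word
      at x, so summing over y is a matrix product.\<close>
    define L' where "L' = L(s := L s @ L x)"
    have "(\<Sum>y\<in>UNIV. word_matrix (L x) w $ y $ ((a(x := y)) (\<sigma> x))
        * (\<Prod>t\<in>S. word_matrix (L t) w $ a t $ ((a(x := y)) (\<sigma> t))))
      = (\<Prod>t\<in>S. word_matrix (L' t) w $ a t $ a (\<sigma>' t))" for a and w :: "('k, 'n, 'm, 'd) W"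
    proof -
      let ?P = "\<Prod>t\<in>S - {s}. word_matrix (L t) w $ a t $ a (\<sigma> t)"
      have "(\<Prod>t\<in>S. word_matrix (L t) w $ a t $ ((a(x := y)) (\<sigma> t)))
          = word_matrix (L s) w $ a s $ y * ?P" for y
        using insert.hyps s other by (subst prod.remove[of S s]) (auto simp: \<sigma>s intro!: prod.cong)
      then have "(\<Sum>y\<in>UNIV. word_matrix (L x) w $ y $ ((a(x := y)) (\<sigma> x))
          * (\<Prod>t\<in>S. word_matrix (L t) w $ a t $ ((a(x := y)) (\<sigma> t))))
        = (\<Sum>y\<in>UNIV. word_matrix (L s) w $ a s $ y * word_matrix (L x) w $ y $ a (\<sigma> x)) * ?P"
        using False by (simp add: sum_distrib_left sum_distrib_right mult_ac)
      also have "\<dots> = word_matrix (L' s) w $ a s $ a (\<sigma>' s)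
          * (\<Prod>t\<in>S - {s}. word_matrix (L' t) w $ a t $ a (\<sigma>' t))"
        using other by (simp add: L'_def word_matrix_append matrix_matrix_mult_def \<sigma>'s)
      also have "\<dots> = (\<Prod>t\<in>S. word_matrix (L' t) w $ a t $ a (\<sigma>' t))"
        using insert.hyps s by (subst prod.remove[of S s]) auto
      finally show ?thesis .
    qed
    then show ?thesis
      unfolding expand using insert.IH[OF perm, of L'] insert.prems by (simp add: L'_def)
  qed
qed

section \<open>The exchange law\<close>

definition left_mul :: "'k::field^'n^'n \<Rightarrow> 'k^'m^'n^'d \<Rightarrow> 'k^'m^'n^'d" where
  "left_mul g Q = (\<chi> i. g ** Q $ i)"

definition right_mul :: "'k::field^'m^'n^'d \<Rightarrow> 'k^'m^'m \<Rightarrow> 'k^'m^'n^'d" where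
  "right_mul Q g = (\<chi> i. Q $ i ** g)"

definition scale_tuple :: "'k::field \<Rightarrow> 'k^'m^'n^'d \<Rightarrow> 'k^'m^'n^'d" where
  "scale_tuple x Q = (\<chi> i a b. x * Q $ i $ a $ b)"

lemma scaleW_eq: "scaleW x (Q, R) = (scale_tuple x Q, scale_tuple x R)"
  by (simp add: scaleW_def scale_tuple_def)

lemma left_mul_scale_tuple: "left_mul g (scale_tuple x Q) = scale_tuple x (left_mul g Q)"
  by (simp add: left_mul_def scale_tuple_def vec_eq_iff matrix_matrix_mult_def sum_distrib_left mult.left_commute)

lemma right_mul_scale_tuple: "right_mul (scale_tuple x Q) g = scale_tuple x (right_mul Q g)"
  by (simp add: right_mul_def scale_tuple_def vec_eq_iff matrix_matrix_mult_def sum_distrib_left mult.assoc)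

definition polyfun :: "('k::comm_ring_1 \<Rightarrow> 'k) \<Rightarrow> bool" where
  "polyfun h \<longleftrightarrow> (\<exists>p. \<forall>x. h x = poly p x)"

lemma polyfun_intros:
  "polyfun (\<lambda>x. c)" "polyfun (\<lambda>x. x)"
  "polyfun f \<Longrightarrow> polyfun g \<Longrightarrow> polyfun (\<lambda>x. f x + g x)"
  "polyfun f \<Longrightarrow> polyfun g \<Longrightarrow> polyfun (\<lambda>x. f x * g x)"
proof -
  show "polyfun (\<lambda>x. c)" unfolding polyfun_def by (intro exI[of _ "[:c:]"]) simp
  show "polyfun (\<lambda>x. x)" unfolding polyfun_def by (intro exI[of _ "[:0, 1:]"]) simp
  show "polyfun f \<Longrightarrow> polyfun g \<Longrightarrow> polyfun (\<lambda>x. f x + g x)"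
    unfolding polyfun_def by (metis poly_add)
  show "polyfun f \<Longrightarrow> polyfun g \<Longrightarrow> polyfun (\<lambda>x. f x * g x)"
    unfolding polyfun_def by (metis poly_mult)
qed

lemma polyfun_sum: "(\<And>i. i \<in> I \<Longrightarrow> polyfun (f i)) \<Longrightarrow> polyfun (\<lambda>x. \<Sum>i\<in>I. f i x)"
  by (induction I rule: infinite_finite_induct) (auto intro: polyfun_intros)

lemma polyfun_prod: "(\<And>i. i \<in> I \<Longrightarrow> polyfun (f i)) \<Longrightarrow> polyfun (\<lambda>x. \<Prod>i\<in>I. f i x)"
  by (induction I rule: infinite_finite_induct) (auto intro: polyfun_intros)

text \<open>Linear forms are affine along a line. This replaces topological density: identities are
  extended within one-variable polynomials.\<close>

lemma polyfun_polynomial_function_line: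
  assumes "f \<in> polynomial_functions scaleW"
  shows "polyfun (\<lambda>x. f (v + scaleW x w))"
  using assms unfolding polynomial_functions_def
proof induction
  case (base f)
  then have "Vector_Spaces.linear scaleW (*) f" by simp
  then interpret f: Vector_Spaces.linear scaleW "(*)" f .
  have "f (v + scaleW x w) = f v + x * f w" for x by (simp only: f.add f.scale)
  then show ?case by (simp add: polyfun_intros)
qed (auto intro: polyfun_intros)

definition matrix_line :: "'k::field^'n^'n \<Rightarrow> 'k \<Rightarrow> 'k^'n^'n" where
  "matrix_line g x = (\<chi> a b. mat 1 $ a $ b + x * (g - mat 1) $ a $ b)"

text \<open>Multiplying a fixed matrix by the moving one again traces a line, which is the shape
  \<open>polyfun_polynomial_function_line\<close> accepts.\<close>

lemma matrix_line_mult: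
  "matrix_line g x ** A = (\<chi> a b. A $ a $ b + x * (g ** A - A) $ a $ b)"
  "B ** matrix_line g x = (\<chi> a b. B $ a $ b + x * (B ** g - B) $ a $ b)"
proof -
  have "(matrix_line g x ** A) $ a $ b = (mat 1 ** A) $ a $ b + x * ((g ** A) $ a $ b - (mat 1 ** A) $ a $ b)" for a b
    unfolding matrix_line_def matrix_matrix_mult_def
    by (simp add: algebra_simps sum.distrib sum_distrib_left sum_subtractf)
  then show "matrix_line g x ** A = (\<chi> a b. A $ a $ b + x * (g ** A - A) $ a $ b)"
    by (simp add: vec_eq_iff)
  have "(B ** matrix_line g x) $ a $ b = (B ** mat 1) $ a $ b + x * ((B ** g) $ a $ b - (B ** mat 1) $ a $ b)" for a b
    unfolding matrix_line_def matrix_matrix_mult_def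
    by (simp add: algebra_simps sum.distrib sum_distrib_left sum_subtractf)
  then show "B ** matrix_line g x = (\<chi> a b. B $ a $ b + x * (B ** g - B) $ a $ b)"
    by (simp add: vec_eq_iff)
qed

lemma polyfun_det_matrix_line: "polyfun (\<lambda>x. det (matrix_line g x))"
  unfolding det_def matrix_line_def
  by (intro polyfun_sum polyfun_intros polyfun_prod) (simp add: polyfun_intros)

text \<open>For invertible matrices the exchange law is invariance at \<open>(Q g\<^sub>2, R g\<^sub>1)\<close>; along the lines
  joining the identities to \<open>g\<^sub>1\<close> and \<open>g\<^sub>2\<close> it is a polynomial identity, so singular matrices
  are covered as well.\<close>

lemma invariantsW_exchange:
  fixes f :: "('k::field_char_0, 'n::finite, 'm::finite, 'd::finite) W \<Rightarrow> 'k"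
  assumes f: "f \<in> invariantsW"
  shows "f (left_mul g1 Q, left_mul g2 R) = f (right_mul Q g2, right_mul R g1)"
proof -
  have poly: "f \<in> polynomial_functions scaleW" using f by (simp add: invariantsW_def)
  let ?l = "\<lambda>x. (left_mul (matrix_line g1 x) Q, left_mul (matrix_line g2 x) R)"
  let ?r = "\<lambda>x. (right_mul Q (matrix_line g2 x), right_mul R (matrix_line g1 x))"
  have "?l x = (Q, R) + scaleW x (left_mul g1 Q - Q, left_mul g2 R - R)" for x
    by (simp add: left_mul_def scaleW_def matrix_line_mult vec_eq_iff)
  then have "polyfun (\<lambda>x. f (?l x))" using polyfun_polynomial_function_line[OF poly] by simp
  then obtain p where p: "\<And>x. f (?l x) = poly p x" by (auto simp: polyfun_def)
  have "?r x = (Q, R) + scaleW x (right_mul Q g2 - Q, right_mul R g1 - R)" for x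
    by (simp add: right_mul_def scaleW_def matrix_line_mult vec_eq_iff)
  then have "polyfun (\<lambda>x. f (?r x))" using polyfun_polynomial_function_line[OF poly] by simp
  then obtain q where q: "\<And>x. f (?r x) = poly q x" by (auto simp: polyfun_def)
  obtain d1 where d1: "\<And>x. det (matrix_line g1 x) = poly d1 x"
    using polyfun_det_matrix_line[of g1] by (auto simp: polyfun_def)
  obtain d2 where d2: "\<And>x. det (matrix_line g2 x) = poly d2 x"
    using polyfun_det_matrix_line[of g2] by (auto simp: polyfun_def)
  have line0: "matrix_line g 0 = mat 1" and line1: "matrix_line g 1 = g" for g :: "'k^'c^'c"
    by (simp_all add: matrix_line_def vec_eq_iff)
  \<comment> \<open>The determinant factors absorb the parameters at which one of the two matrices
    is singular. They are nonzero polynomials because both lines start at the identity, so they can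
    be cancelled.\<close>
  have "poly ((p - q) * (d1 * d2)) x = 0" for x
  proof (cases "poly (d1 * d2) x = 0")
    case False
    then have inv: "invertible (matrix_line g1 x)" "invertible (matrix_line g2 x)"
      by (auto simp: invertible_det_nz d1 d2)
    have "actW (matrix_line g1 x, matrix_line g2 x) (?r x) = ?l x"
      by (simp add: actW_def left_mul_def right_mul_def matrix_mul_assoc[symmetric]
          matrix_inv_cancel[OF inv(1)] matrix_inv_cancel[OF inv(2)])
    moreover have "f (actW (matrix_line g1 x, matrix_line g2 x) (?r x)) = f (?r x)"
      using f inv by (auto simp: invariantsW_def GL_def)
    ultimately show ?thesis using p q by simp
  qed simp
  then have "(p - q) * (d1 * d2) = 0" using poly_all_0_iff_0 by blast
  moreover have "poly d1 0 \<noteq> 0" "poly d2 0 \<noteq> 0"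
    by (simp_all add: d1[symmetric] d2[symmetric] line0 det_I)
  ultimately have "p = q" by auto
  then show ?thesis using p[of 1] q[of 1] by (simp add: line1)
qed

section \<open>Monomials and bihomogeneous parts\<close>

definition tuple_coord :: "'k^'m^'n^'d \<Rightarrow> 'd \<times> 'n \<times> 'm \<Rightarrow> 'k" where
  "tuple_coord Q = (\<lambda>(i, a, b). Q $ i $ a $ b)"

definition tuple_unit :: "'d \<times> 'n \<times> 'm \<Rightarrow> 'k::field^'m^'n^'d" where
  "tuple_unit p = (\<chi> i a b. if p = (i, a, b) then 1 else 0)"

text \<open>A coefficient with a list of Q-coordinates and a list of R-coordinates. Lists carry
  multiplicities and supply the numbered slots for polarization. A function has many such
  representations, so every argument compares values, never lists.\<close>

fun monomial_eval where
  "monomial_eval (c, us, vs) w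
    = c * (\<Prod>u\<leftarrow>us. tuple_coord (fst w) u) * (\<Prod>v\<leftarrow>vs. tuple_coord (snd w) v)"

lemma sum_list_mult_product:
  fixes f g :: "_ \<Rightarrow> 'k::comm_ring_1"
  shows "(\<Sum>m\<leftarrow>ms. f m) * (\<Sum>n\<leftarrow>ns. g n) = (\<Sum>(m, n)\<leftarrow>List.product ms ns. f m * g n)"
  by (induction ms) (simp_all add: distrib_right sum_list_const_mult o_def)

lemma tuple_expansion:
  fixes Q :: "'k::field^'m::finite^'n::finite^'d::finite"
  shows "Q = (\<Sum>p\<in>UNIV. scale_tuple (tuple_coord Q p) (tuple_unit p))"
  by (simp add: vec_eq_iff sum_component scale_tuple_def tuple_unit_def tuple_coord_def
      if_distrib[of "\<lambda>a. _ * a"] sum.delta cong: if_cong)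

text \<open>Sums of monomials are closed under addition and, by concatenating lists, under
  multiplication. A linear form is one by expansion in matrix units.\<close>

lemma polynomial_function_monomials:
  fixes f :: "('k::field, 'n::finite, 'm::finite, 'd::finite) W \<Rightarrow> 'k"
  assumes "f \<in> polynomial_functions scaleW"
  shows "\<exists>ms. \<forall>w. f w = (\<Sum>m\<leftarrow>ms. monomial_eval m w)"
proof -
  define rep where "rep f \<longleftrightarrow> (\<exists>ms. \<forall>w. f w = (\<Sum>m\<leftarrow>ms. monomial_eval m w))"
    for f :: "('k, 'n, 'm, 'd) W \<Rightarrow> 'k"
  have mono: "rep (monomial_eval m)" for m
    unfolding rep_def by (intro exI[of _ "[m]"]) simp
  have add: "rep (\<lambda>w. f w + g w)" if fg: "rep f" "rep g" for f g
  proof -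
    obtain ms ns where "\<forall>w. f w = (\<Sum>m\<leftarrow>ms. monomial_eval m w)" "\<forall>w. g w = (\<Sum>m\<leftarrow>ns. monomial_eval m w)"
      using fg unfolding rep_def by blast
    then show ?thesis unfolding rep_def by (intro exI[of _ "ms @ ns"]) simp
  qed
  have mult: "rep (\<lambda>w. f w * g w)" if fg: "rep f" "rep g" for f g
  proof -
    obtain ms ns where ms: "\<forall>w. f w = (\<Sum>m\<leftarrow>ms. monomial_eval m w)" "\<forall>w. g w = (\<Sum>m\<leftarrow>ns. monomial_eval m w)"
      using fg unfolding rep_def by blast
    define times where "times = (\<lambda>((c, us, vs), (c', us', vs')).
      (c * c' :: 'k, us @ us' :: ('d \<times> 'n \<times> 'm) list, vs @ vs' :: ('d \<times> 'm \<times> 'n) list))"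
    have "monomial_eval (times p) w = monomial_eval (fst p) w * monomial_eval (snd p) w" for p w
      by (cases p; cases "fst p"; cases "snd p") (simp add: times_def mult_ac)
    then have "f w * g w = (\<Sum>m\<leftarrow>map times (List.product ms ns). monomial_eval m w)" for w
      by (simp add: ms sum_list_mult_product o_def case_prod_beta')
    then show ?thesis unfolding rep_def by blast
  qed
  have const: "rep (\<lambda>w. c)" for c using mono[of "(c, [], [])"] by (simp add: monomial_eval.simps[abs_def])
  have sum: "rep (\<lambda>w. \<Sum>i\<in>I. f i w)" if "\<And>i. i \<in> I \<Longrightarrow> rep (f i)" for f and I :: "'i set"
    using that by (induction I rule: infinite_finite_induct) (auto intro: add const)
  from assms have "rep f" unfolding polynomial_functions_def
  proof induction
    case (base f)
    then have "Vector_Spaces.linear scaleW (*) f" by simp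
    then interpret f: Vector_Spaces.linear scaleW "(*)" f .
    have eq: "f w = (\<Sum>p\<in>UNIV. f (tuple_unit p, 0) * tuple_coord (fst w) p)
        + (\<Sum>p\<in>UNIV. f (0, tuple_unit p) * tuple_coord (snd w) p)" for w
    proof -
      have 0: "scale_tuple x 0 = 0" for x :: 'k by (simp add: scale_tuple_def vec_eq_iff)
      have "w = (\<Sum>p\<in>UNIV. scaleW (tuple_coord (fst w) p) (tuple_unit p, 0))
          + (\<Sum>p\<in>UNIV. scaleW (tuple_coord (snd w) p) (0, tuple_unit p))"
        by (simp add: scaleW_eq prod_eq_iff fst_sum snd_sum 0 tuple_expansion[symmetric])
      then have "f w = f ((\<Sum>p\<in>UNIV. scaleW (tuple_coord (fst w) p) (tuple_unit p, 0))
          + (\<Sum>p\<in>UNIV. scaleW (tuple_coord (snd w) p) (0, tuple_unit p)))" by simp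
      then show ?thesis by (simp add: f.add f.sum f.scale mult.commute)
    qed
    have coord: "rep (\<lambda>w. c * tuple_coord (fst w) p)" "rep (\<lambda>w. c * tuple_coord (snd w) q)" for c p q
      using mono[of "(c, [p], [])"] mono[of "(c, [], [q])"]
      by (simp_all add: monomial_eval.simps[abs_def])
    have "rep (\<lambda>w. (\<Sum>p\<in>UNIV. f (tuple_unit p, 0) * tuple_coord (fst w) p)
        + (\<Sum>p\<in>UNIV. f (0, tuple_unit p) * tuple_coord (snd w) p))"
      by (intro add sum coord)
    then show ?case unfolding rep_def eq[symmetric] .
  qed (auto intro: add mult const)
  then show ?thesis by (simp add: rep_def)
qed

lemma polynomial_coeff_eq_0:
  fixes c :: "nat \<Rightarrow> 'k::{idom, ring_char_0}"
  assumes "\<And>x. (\<Sum>i\<le>N. c i * x ^ i) = 0" "i \<le> N"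
  shows "c i = 0"
proof -
  have "poly (\<Sum>i\<le>N. monom (c i) i) x = 0" for x
    using assms(1)[of x] by (simp add: poly_sum poly_monom)
  then have "(\<Sum>i\<le>N. monom (c i) i) = 0" using poly_all_0_iff_0 by blast
  then have "coeff (\<Sum>i\<le>N. monom (c i) i) i = 0" by simp
  then show ?thesis using assms(2) by (simp add: coeff_sum sum.delta')
qed

definition bidegree_part where
  "bidegree_part r s = filter (\<lambda>(c, us, vs). length us = r \<and> length vs = s)"

lemma sum_list_bidegree_parts:
  fixes F :: "_ \<Rightarrow> 'k::comm_ring_1"
  assumes "\<And>c us vs. (c, us, vs) \<in> set ms \<Longrightarrow> length us \<le> N \<and> length vs \<le> N"
  shows "(\<Sum>m\<leftarrow>ms. F m) = (\<Sum>r\<le>N. \<Sum>s\<le>N. \<Sum>m\<leftarrow>bidegree_part r s ms. F m)"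
  using assms
proof (induction ms)
  case Nil
  then show ?case by (simp add: bidegree_part_def)
next
  case (Cons m ms)
  obtain c us vs where m: "m = (c, us, vs)" by (cases m)
  have le: "length us \<le> N" "length vs \<le> N" using Cons.prems m by auto
  have "(\<Sum>m\<leftarrow>bidegree_part r s (m # ms). F m)
      = (if r = length us then if s = length vs then F m else 0 else 0) + (\<Sum>m\<leftarrow>bidegree_part r s ms. F m)" for r s
    by (auto simp: bidegree_part_def m)
  moreover have "(\<Sum>s\<le>N. if r = length us then if s = length vs then F m else 0 else 0)
      = (if r = length us then F m else 0)" for r
    using le by simp
  moreover have "(\<Sum>m\<leftarrow>ms. F m) = (\<Sum>r\<le>N. \<Sum>s\<le>N. \<Sum>m\<leftarrow>bidegree_part r s ms. F m)"
    by (rule Cons.IH) (use Cons.prems in auto)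
  ultimately show ?case using le by (simp add: sum.distrib)
qed

lemma monomial_eval_scale:
  fixes Q :: "'k::field^'m::finite^'n::finite^'d::finite" and R :: "'k^'n^'m^'d"
  shows "monomial_eval (c, us, vs) (scale_tuple x Q, scale_tuple y R)
    = x ^ length us * y ^ length vs * monomial_eval (c, us, vs) (Q, R)"
proof -
  have "(\<Prod>u\<leftarrow>us. tuple_coord (scale_tuple x A) u) = x ^ length us * (\<Prod>u\<leftarrow>us. tuple_coord A u)"
    for x us and A :: "'k^'q::finite^'p::finite^'d"
    by (induction us) (simp_all add: tuple_coord_def scale_tuple_def case_prod_beta mult_ac)
  from this[of x Q us] this[of y R vs] show ?thesis by (simp add: mult_ac)
qed

lemma bidegree_part_scale:
  fixes Q :: "'k::field^'m::finite^'n::finite^'d::finite" and R :: "'k^'n^'m^'d"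
  shows
  "(\<Sum>m\<leftarrow>bidegree_part r s ms. monomial_eval m (scale_tuple x Q, scale_tuple y R))
    = x ^ r * y ^ s * (\<Sum>m\<leftarrow>bidegree_part r s ms. monomial_eval m (Q, R))"
proof -
  have "(\<Sum>m\<leftarrow>bidegree_part r s ms. monomial_eval m (scale_tuple x Q, scale_tuple y R))
      = (\<Sum>m\<leftarrow>bidegree_part r s ms. x ^ r * y ^ s * monomial_eval m (Q, R))"
    by (intro arg_cong[where f = sum_list] map_cong refl)
      (auto simp: bidegree_part_def monomial_eval_scale simp del: monomial_eval.simps)
  then show ?thesis by (simp add: sum_list_const_mult)
qed

text \<open>Scaling Q by x and R by y multiplies the part of bidegree (r, s) by x^r y^s and commutes
  with multiplication by matrices on either side. The exchange law therefore splits into one law for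
  each bidegree.\<close>

lemma invariantsW_bihomogeneous:
  fixes f :: "('k::field_char_0, 'n::finite, 'm::finite, 'd::finite) W \<Rightarrow> 'k"
  assumes "f \<in> invariantsW"
  obtains N ms where
    "\<And>s c us vs. (c, us, vs) \<in> set (ms s) \<Longrightarrow> length us = s \<and> length vs = s"
    "\<And>w. f w = (\<Sum>s\<le>N::nat. \<Sum>m\<leftarrow>ms s. monomial_eval m w)"
    "\<And>s g1 g2 Q R. s \<le> N \<Longrightarrow>
      (\<Sum>m\<leftarrow>ms s. monomial_eval m (left_mul g1 Q, left_mul g2 R))
      = (\<Sum>m\<leftarrow>ms s. monomial_eval m (right_mul Q g2, right_mul R g1))"
proof -
  obtain ms where ms: "\<And>w. f w = (\<Sum>m\<leftarrow>ms. monomial_eval m w)"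
    using polynomial_function_monomials[of f] assms by (auto simp: invariantsW_def)
  \<comment> \<open>A crude common bound for the degrees in Q and in R; the sum of all lengths
    avoids a maximum over a possibly empty list.\<close>
  define N where "N = (\<Sum>(c, us, vs)\<leftarrow>ms. length us + length vs)"
  have N: "length us \<le> N \<and> length vs \<le> N" if "(c, us, vs) \<in> set ms" for c us vs
    using member_le_sum_list[of "length us + length vs" "map (\<lambda>(c, us, vs). length us + length vs) ms"] that
    unfolding N_def by force
  define h where "h r s w = (\<Sum>m\<leftarrow>bidegree_part r s ms. monomial_eval m w)" for r s w
  have f: "f w = (\<Sum>r\<le>N. \<Sum>s\<le>N. h r s w)" for w
    unfolding ms h_def by (rule sum_list_bidegree_parts) (rule N)
  have h_scale: "h r s (scale_tuple x Q, scale_tuple y R) = x ^ r * y ^ s * h r s (Q, R)" for r s x y Q R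
    unfolding h_def by (rule bidegree_part_scale)
  have h: "h r s (left_mul g1 Q, left_mul g2 R) = h r s (right_mul Q g2, right_mul R g1)"
    if "r \<le> N" "s \<le> N" for r s g1 g2 Q R
  proof -
    let ?D = "\<lambda>r s. h r s (left_mul g1 Q, left_mul g2 R) - h r s (right_mul Q g2, right_mul R g1)"
    have *: "(\<Sum>r\<le>N. (\<Sum>s\<le>N. ?D r s * y ^ s) * x ^ r) = 0" for x y
    proof -
      have "f (left_mul g1 (scale_tuple x Q), left_mul g2 (scale_tuple y R))
          = f (right_mul (scale_tuple x Q) g2, right_mul (scale_tuple y R) g1)"
        by (rule invariantsW_exchange[OF assms])
      then have "(\<Sum>r\<le>N. \<Sum>s\<le>N. x ^ r * y ^ s * ?D r s) = 0"
        by (simp add: f left_mul_scale_tuple right_mul_scale_tuple h_scale right_diff_distrib sum_subtractf)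
      then show ?thesis by (simp add: sum_distrib_left mult_ac)
    qed
    \<comment> \<open>Coefficients are compared in x for fixed y, then in y.\<close>
    have "(\<Sum>s\<le>N. ?D r s * y ^ s) = 0" for y
      by (rule polynomial_coeff_eq_0[OF * \<open>r \<le> N\<close>])
    then have "?D r s = 0" by (rule polynomial_coeff_eq_0) fact
    then show ?thesis by simp
  qed
  have off: "h r s (Q, R) = 0" if "r \<le> N" "s \<le> N" "r \<noteq> s" for r s Q R
  proof -
    have two: "left_mul (mat 2) A = scale_tuple 2 A" "right_mul A (mat 2) = scale_tuple 2 A"
       "left_mul (mat 1) A = scale_tuple 1 A" "right_mul A (mat 1) = scale_tuple 1 A"
      for A :: "'k^'a::finite^'b::finite^'d"
      by (simp_all add: left_mul_def right_mul_def scale_tuple_def mat_def matrix_matrix_mult_def vec_eq_iff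
          if_distrib[of "\<lambda>a. _ * a"] if_distrib[of "\<lambda>a. a * _"] mult.commute cong: if_cong)
    \<comment> \<open>With \<open>g1\<close> twice the identity and \<open>g2\<close> the identity,
      the exchange law compares the values at (2Q, R) and (Q, 2R).\<close>
    have "2 ^ r * h r s (Q, R) = 2 ^ s * h r s (Q, R)"
      using h[OF that(1,2), of "mat 2" Q "mat 1" R] by (simp add: two h_scale)
    moreover have "(2::'k) ^ r \<noteq> 2 ^ s"
      using that(3) by (metis of_nat_eq_iff of_nat_numeral of_nat_power one_less_numeral_iff
          power_inject_exp semiring_norm(76))
    ultimately show ?thesis by simp
  qed
  show ?thesis
  proof (rule that[of "\<lambda>s. bidegree_part s s ms" N])
    fix w
    have "f w = (\<Sum>r\<le>N. \<Sum>s\<le>N. if r = s then h r s w else 0)"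
      unfolding f using off by (intro sum.cong refl) (cases w; auto)
    then show "f w = (\<Sum>s\<le>N. \<Sum>m\<leftarrow>bidegree_part s s ms. monomial_eval m w)"
      by (simp add: h_def)
  qed (use h in \<open>auto simp: h_def bidegree_part_def\<close>)
qed

section \<open>Polarization\<close>

text \<open>A permanent: the unnormalized symmetric multilinear form attached to a monomial of
  degree s. Only the slots below s matter.\<close>

definition polarized_monomial :: "nat \<Rightarrow> ('d \<times> 'n \<times> 'm) list \<Rightarrow> (nat \<Rightarrow> 'k::field^'m^'n^'d) \<Rightarrow> 'k" where
  "polarized_monomial s us y
    = (\<Sum>\<sigma> | \<sigma> permutes {..<s}. \<Prod>t<s. tuple_coord (y (\<sigma> t)) (us ! t))"

text \<open>Q and R are polarized separately, with s slots each, so that \<open>g1\<close> and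
  \<open>g2\<close> act on different sets of indices.\<close>

definition polarization where
  "polarization s ms y z
    = (\<Sum>(c, us, vs)\<leftarrow>ms. c * polarized_monomial s us y * polarized_monomial s vs z)"

lemma tuple_coord_sum: "tuple_coord (\<Sum>i\<in>I. y i) p = (\<Sum>i\<in>I. tuple_coord (y i) p)"
  by (simp add: tuple_coord_def case_prod_beta sum_component)

lemma tuple_coord_scale: "tuple_coord (scale_tuple x Q) p = x * tuple_coord Q p"
  by (simp add: tuple_coord_def scale_tuple_def case_prod_beta)

lemma left_mul_sum: "left_mul g (\<Sum>i\<in>I. y i) = (\<Sum>i\<in>I. left_mul g (y i))"
  by (simp add: left_mul_def vec_eq_iff sum_component matrix_matrix_mult_def sum_distrib_left)
    (intro allI sum.swap)

lemma right_mul_sum: "right_mul (\<Sum>i\<in>I. y i) g = (\<Sum>i\<in>I. right_mul (y i) g)"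
  by (simp add: right_mul_def vec_eq_iff sum_component matrix_matrix_mult_def sum_distrib_right)
    (intro allI sum.swap)

lemma prod_list_lessThan: "length us = s \<Longrightarrow> (\<Prod>u\<leftarrow>us. f u) = (\<Prod>t<s. f (us ! t))"
  for f :: "_ \<Rightarrow> 'k::comm_monoid_mult"
  by (simp add: prod.list_conv_set_nth atLeast0LessThan)

lemma polarized_monomial_alternating_sum:
  assumes "length us = s"
  shows "polarized_monomial s us y
    = (\<Sum>T\<in>Pow {..<s}. (-1) ^ (s - card T) * (\<Prod>u\<leftarrow>us. tuple_coord (\<Sum>t\<in>T. y t) u))"
  using alternating_sum_prod_eq_sum_permutes[of "{..<s}" "\<lambda>t' t. tuple_coord (y t') (us ! t)"]
  by (simp add: polarized_monomial_def prod_list_lessThan[OF assms] tuple_coord_sum)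

text \<open>Ryser's formula in both groups of slots. Only values of the represented function at
  partial sums occur, so properties of that function pass to its polarization.\<close>

lemma polarization_alternating_sum:
  assumes "\<And>c us vs. (c, us, vs) \<in> set ms \<Longrightarrow> length us = s \<and> length vs = s"
  shows "polarization s ms y z
    = (\<Sum>T\<in>Pow {..<s}. \<Sum>T'\<in>Pow {..<s}. (-1) ^ (s - card T) * (-1) ^ (s - card T')
        * (\<Sum>m\<leftarrow>ms. monomial_eval m (\<Sum>t\<in>T. y t, \<Sum>t\<in>T'. z t)))"
  using assms
proof (induction ms)
  case Nil
  then show ?case by (simp add: polarization_def)
next
  case (Cons m ms)
  obtain c us vs where m: "m = (c, us, vs)" by (cases m)
  have len: "length us = s" "length vs = s" using Cons.prems m by auto
  have "c * polarized_monomial s us y * polarized_monomial s vs z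
    = (\<Sum>T\<in>Pow {..<s}. \<Sum>T'\<in>Pow {..<s}. (-1) ^ (s - card T) * (-1) ^ (s - card T')
        * monomial_eval m (\<Sum>t\<in>T. y t, \<Sum>t\<in>T'. z t))"
    unfolding polarized_monomial_alternating_sum[OF len(1)] polarized_monomial_alternating_sum[OF len(2)]
      mult.assoc sum_product
    by (simp add: sum_distrib_left m mult_ac)
  moreover have "polarization s ms y z
    = (\<Sum>T\<in>Pow {..<s}. \<Sum>T'\<in>Pow {..<s}. (-1) ^ (s - card T) * (-1) ^ (s - card T')
        * (\<Sum>m\<leftarrow>ms. monomial_eval m (\<Sum>t\<in>T. y t, \<Sum>t\<in>T'. z t)))"
    by (rule Cons.IH) (use Cons.prems in auto)
  ultimately show ?case
    by (simp add: polarization_def m distrib_left sum.distrib del: monomial_eval.simps)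
qed

text \<open>On the diagonal each of the s! permutations contributes the same product, once for Q and
  once for R. This recovers the function from its polarization.\<close>

lemma polarization_const:
  fixes Q :: "'k::field_char_0^'m::finite^'n::finite^'d::finite" and R :: "'k^'n^'m^'d"
  assumes "\<And>c us vs. (c, us, vs) \<in> set ms \<Longrightarrow> length us = s \<and> length vs = s"
  shows "polarization s ms (\<lambda>_. Q) (\<lambda>_. R) = (fact s)\<^sup>2 * (\<Sum>m\<leftarrow>ms. monomial_eval m (Q, R))"
proof -
  have c: "polarized_monomial s us (\<lambda>_. A) = fact s * (\<Prod>u\<leftarrow>us. tuple_coord A u)"
    if "length us = s" for us and A :: "'k^'q::finite^'p::finite^'d"
    using card_permutations[of "{..<s}" s]
    by (simp add: polarized_monomial_def prod_list_lessThan[OF that])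
  have "polarization s ms (\<lambda>_. Q) (\<lambda>_. R) = (\<Sum>m\<leftarrow>ms. (fact s)\<^sup>2 * monomial_eval m (Q, R))"
    unfolding polarization_def
    by (intro arg_cong[where f = sum_list] map_cong refl)
      (auto simp: c assms power2_eq_square mult_ac)
  then show ?thesis by (simp add: sum_list_const_mult)
qed

text \<open>Permutations of {..<s} keep slots below s. This allows slots given by restricted
  multi-indices to be replaced by their unrestricted formulas.\<close>

lemma polarized_monomial_cong:
  assumes "\<And>t. t < s \<Longrightarrow> y t = y' t"
  shows "polarized_monomial s us y = polarized_monomial s us y'"
proof -
  have "y (\<sigma> t) = y' (\<sigma> t)" if "\<sigma> permutes {..<s}" "t < s" for \<sigma> t
    using assms permutes_in_image[OF that(1), of t] that(2) by simp
  then show ?thesis by (auto simp: polarized_monomial_def intro!: sum.cong prod.cong)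
qed

lemma polarization_cong:
  assumes "\<And>t. t < s \<Longrightarrow> y t = y' t" "\<And>t. t < s \<Longrightarrow> z t = z' t"
  shows "polarization s ms y z = polarization s ms y' z'"
  unfolding polarization_def
  using polarized_monomial_cong[of s y y'] polarized_monomial_cong[of s z z'] assms by simp

lemma polarized_monomial_multilinear:
  fixes Y :: "nat \<Rightarrow> 'a \<Rightarrow> 'k::field^'m::finite^'n::finite^'d::finite"
  assumes "finite A"
  shows "polarized_monomial s us (\<lambda>t. \<Sum>\<alpha>\<in>A. scale_tuple (c t \<alpha>) (Y t \<alpha>))
    = (\<Sum>\<alpha>\<in>{..<s} \<rightarrow>\<^sub>E A. (\<Prod>t<s. c t (\<alpha> t)) * polarized_monomial s us (\<lambda>t. Y t (\<alpha> t)))"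
proof -
  have "(\<Prod>t<s. \<Sum>\<alpha>\<in>A. c (\<sigma> t) \<alpha> * tuple_coord (Y (\<sigma> t) \<alpha>) (us ! t))
    = (\<Sum>\<alpha>\<in>{..<s} \<rightarrow>\<^sub>E A. (\<Prod>t<s. c t (\<alpha> t)) * (\<Prod>t<s. tuple_coord (Y (\<sigma> t) (\<alpha> (\<sigma> t))) (us ! t)))"
    if \<sigma>: "\<sigma> permutes {..<s}" for \<sigma>
  proof -
    have "(\<Prod>t<s. \<Sum>\<alpha>\<in>A. c (\<sigma> t) \<alpha> * tuple_coord (Y (\<sigma> t) \<alpha>) (us ! t))
      = (\<Sum>\<beta>\<in>{..<s} \<rightarrow>\<^sub>E A. \<Prod>t<s. c (\<sigma> t) (\<beta> t) * tuple_coord (Y (\<sigma> t) (\<beta> t)) (us ! t))"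
      using assms by (intro prod_sum_PiE) auto
    \<comment> \<open>The choices are relabelled to belong to the vector in slot
      \<open>\<sigma> t\<close> instead of the factor t. The coefficient product then no longer
      depends on \<sigma>.\<close>
    also have "\<dots> = (\<Sum>\<alpha>\<in>{..<s} \<rightarrow>\<^sub>E A. \<Prod>t<s. c (\<sigma> t) ((\<alpha> \<circ> \<sigma>) t) * tuple_coord (Y (\<sigma> t) ((\<alpha> \<circ> \<sigma>) t)) (us ! t))"
      using sum.reindex_bij_betw[OF bij_betw_comp_permutes_PiE[OF \<sigma>],
        of "\<lambda>\<beta>. \<Prod>t<s. c (\<sigma> t) (\<beta> t) * tuple_coord (Y (\<sigma> t) (\<beta> t)) (us ! t)"] by simp
    also have "\<dots> = (\<Sum>\<alpha>\<in>{..<s} \<rightarrow>\<^sub>E A. (\<Prod>t<s. c (\<sigma> t) (\<alpha> (\<sigma> t))) * (\<Prod>t<s. tuple_coord (Y (\<sigma> t) (\<alpha> (\<sigma> t))) (us ! t)))"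
      by (simp add: prod.distrib)
    also have "\<dots> = (\<Sum>\<alpha>\<in>{..<s} \<rightarrow>\<^sub>E A. (\<Prod>t<s. c t (\<alpha> t)) * (\<Prod>t<s. tuple_coord (Y (\<sigma> t) (\<alpha> (\<sigma> t))) (us ! t)))"
      using prod.permute[OF \<sigma>, of "\<lambda>t. c t (\<alpha> t)" for \<alpha>] by (simp add: o_def)
    finally show ?thesis .
  qed
  then have "polarized_monomial s us (\<lambda>t. \<Sum>\<alpha>\<in>A. scale_tuple (c t \<alpha>) (Y t \<alpha>))
    = (\<Sum>\<sigma> | \<sigma> permutes {..<s}. \<Sum>\<alpha>\<in>{..<s} \<rightarrow>\<^sub>E A. (\<Prod>t<s. c t (\<alpha> t)) * (\<Prod>t<s. tuple_coord (Y (\<sigma> t) (\<alpha> (\<sigma> t))) (us ! t)))"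
    by (simp add: polarized_monomial_def tuple_coord_sum tuple_coord_scale)
  also have "\<dots> = (\<Sum>\<alpha>\<in>{..<s} \<rightarrow>\<^sub>E A. (\<Prod>t<s. c t (\<alpha> t)) * polarized_monomial s us (\<lambda>t. Y t (\<alpha> t)))"
    by (subst sum.swap) (simp add: polarized_monomial_def sum_distrib_left)
  finally show ?thesis .
qed

lemma polarization_multilinear:
  fixes Y :: "nat \<Rightarrow> 'a \<Rightarrow> 'k::field^'m::finite^'n::finite^'d::finite"
    and Z :: "nat \<Rightarrow> 'b \<Rightarrow> 'k^'n^'m^'d"
  assumes "finite A" "finite B"
  shows "polarization s ms (\<lambda>t. \<Sum>\<alpha>\<in>A. scale_tuple (c t \<alpha>) (Y t \<alpha>)) (\<lambda>t. \<Sum>\<beta>\<in>B. scale_tuple (e t \<beta>) (Z t \<beta>))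
    = (\<Sum>\<alpha>\<in>{..<s} \<rightarrow>\<^sub>E A. \<Sum>\<beta>\<in>{..<s} \<rightarrow>\<^sub>E B. (\<Prod>t<s. c t (\<alpha> t)) * (\<Prod>t<s. e t (\<beta> t))
        * polarization s ms (\<lambda>t. Y t (\<alpha> t)) (\<lambda>t. Z t (\<beta> t)))"
proof (induction ms)
  case Nil
  then show ?case by (simp add: polarization_def)
next
  case (Cons m ms)
  obtain x us vs where m: "m = (x, us, vs)" by (cases m)
  have "polarization s (m # ms) y z = x * polarized_monomial s us y * polarized_monomial s vs z + polarization s ms y z"
    for y :: "nat \<Rightarrow> 'k^'m^'n^'d" and z :: "nat \<Rightarrow> 'k^'n^'m^'d"
    by (simp add: polarization_def m)
  moreover have "x * (\<Sum>\<alpha>\<in>{..<s} \<rightarrow>\<^sub>E A. (\<Prod>t<s. c t (\<alpha> t)) * polarized_monomial s us (\<lambda>t. Y t (\<alpha> t)))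
      * (\<Sum>\<beta>\<in>{..<s} \<rightarrow>\<^sub>E B. (\<Prod>t<s. e t (\<beta> t)) * polarized_monomial s vs (\<lambda>t. Z t (\<beta> t)))
    = (\<Sum>\<alpha>\<in>{..<s} \<rightarrow>\<^sub>E A. \<Sum>\<beta>\<in>{..<s} \<rightarrow>\<^sub>E B. (\<Prod>t<s. c t (\<alpha> t)) * (\<Prod>t<s. e t (\<beta> t))
        * (x * polarized_monomial s us (\<lambda>t. Y t (\<alpha> t)) * polarized_monomial s vs (\<lambda>t. Z t (\<beta> t))))"
    by (simp add: mult.assoc sum_product sum_distrib_left mult_ac)
  ultimately show ?case
    by (simp only: polarized_monomial_multilinear[OF assms(1)] polarized_monomial_multilinear[OF assms(2)]
        Cons.IH distrib_left sum.distrib)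
qed

section \<open>The coefficients of the polarization\<close>

lemma left_mul_tuple_unit:
  "left_mul g (tuple_unit (i, a', b)) = (\<Sum>a\<in>UNIV. scale_tuple (g $ a $ a') (tuple_unit (i, a, b)))"
proof -
  have "left_mul g (tuple_unit (i, a', b)) $ j $ c $ e
      = (\<Sum>a\<in>UNIV. scale_tuple (g $ a $ a') (tuple_unit (i, a, b))) $ j $ c $ e" for j c e
    by (cases "i = j"; cases "b = e")
      (simp_all add: left_mul_def tuple_unit_def scale_tuple_def matrix_matrix_mult_def sum_component
        if_distrib[of "\<lambda>a. _ * a"] cong: if_cong)
  then show ?thesis by (simp add: vec_eq_iff)
qed

lemma right_mul_tuple_unit:
  "right_mul (tuple_unit (i, a, b')) g = (\<Sum>b\<in>UNIV. scale_tuple (g $ b' $ b) (tuple_unit (i, a, b)))"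
proof -
  have "right_mul (tuple_unit (i, a, b')) g $ j $ c $ e
      = (\<Sum>b\<in>UNIV. scale_tuple (g $ b' $ b) (tuple_unit (i, a, b))) $ j $ c $ e" for j c e
    by (cases "i = j"; cases "a = c")
      (simp_all add: right_mul_def tuple_unit_def scale_tuple_def matrix_matrix_mult_def sum_component
        if_distrib[of "\<lambda>a. _ * a"] if_distrib[of "\<lambda>a. a * _"] cong: if_cong)
  then show ?thesis by (simp add: vec_eq_iff)
qed

lemma sum_PiE_triple:
  "(\<Sum>\<alpha>\<in>S \<rightarrow>\<^sub>E UNIV. F \<alpha>) = (\<Sum>i\<in>S \<rightarrow>\<^sub>E UNIV. \<Sum>a\<in>S \<rightarrow>\<^sub>E UNIV. \<Sum>b\<in>S \<rightarrow>\<^sub>E UNIV.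
    F (\<lambda>t\<in>S. (i t, a t, b t)))"
  unfolding sum.cartesian_product
  by (rule sum.reindex_bij_witness[where
        i = "\<lambda>(i, a, b). \<lambda>t\<in>S. (i t, a t, b t)" and
        j = "\<lambda>\<alpha>. (\<lambda>t\<in>S. fst (\<alpha> t), \<lambda>t\<in>S. fst (snd (\<alpha> t)), \<lambda>t\<in>S. snd (snd (\<alpha> t)))"])
    (auto simp: fun_eq_iff PiE_iff extensional_def intro!: arg_cong[where f = F])


text \<open>Multiplication on either side is additive, so it passes through the partial sums of the
  alternating formula, where \<open>exch\<close> applies term by term.\<close>

lemma polarization_exchange:
  assumes len: "\<And>c us vs. (c, us, vs) \<in> set ms \<Longrightarrow> length us = s \<and> length vs = s"
    and exch: "\<And>g1 g2 Q R. (\<Sum>m\<leftarrow>ms. monomial_eval m (left_mul g1 Q, left_mul g2 R))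
      = (\<Sum>m\<leftarrow>ms. monomial_eval m (right_mul Q g2, right_mul R g1))"
  shows "polarization s ms (\<lambda>t. left_mul g1 (y t)) (\<lambda>t. left_mul g2 (z t))
    = polarization s ms (\<lambda>t. right_mul (y t) g2) (\<lambda>t. right_mul (z t) g1)"
  by (simp only: polarization_alternating_sum[OF len] left_mul_sum[symmetric] right_mul_sum[symmetric] exch)

text \<open>The exchange law says exactly that the matrix of coefficients of the polarization commutes with
  every \<open>g\<^sub>1\<close> tensor power times every \<open>g\<^sub>2\<close> tensor power.\<close>

lemma polarization_coefficients_permutations:
  fixes ms :: "('k::field_char_0 \<times> ('d::finite \<times> 'n::finite \<times> 'm::finite) list \<times> ('d \<times> 'm \<times> 'n) list) list"
    and i j :: "nat \<Rightarrow> 'd"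
  assumes len: "\<And>c us vs. (c, us, vs) \<in> set ms \<Longrightarrow> length us = s \<and> length vs = s"
    and exch: "\<And>g1 g2 Q R. (\<Sum>m\<leftarrow>ms. monomial_eval m (left_mul g1 Q, left_mul g2 R))
      = (\<Sum>m\<leftarrow>ms. monomial_eval m (right_mul Q g2, right_mul R g1))"
  defines "X \<equiv> ({..<s} \<rightarrow>\<^sub>E UNIV) \<times> ({..<s} \<rightarrow>\<^sub>E UNIV)"
  defines "G \<equiv> {\<sigma>. \<sigma> permutes {..<s}} \<times> {\<tau>. \<tau> permutes {..<s}}"
  shows "\<exists>l. \<forall>u\<in>X. \<forall>w\<in>X.
    polarization s ms (\<lambda>t. tuple_unit (i t, fst w t, snd u t)) (\<lambda>t. tuple_unit (j t, snd w t, fst u t))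
    = (\<Sum>h\<in>G. l h * (if u = permute_pair h w then 1 else 0))"
  unfolding X_def G_def
proof (rule commutant_tensor_powers)
  let ?Y = "{..<s} \<rightarrow>\<^sub>E UNIV"
  let ?\<Phi> = "polarization s ms"
  \<comment> \<open>Here w holds the row indices of Q and R, and u the column indices of R and Q in
    this crossed order, so that first components lie in 'n and second ones in 'm. Left factors then
    act on w and right factors on u.\<close>
  let ?T = "\<lambda>u w. ?\<Phi> (\<lambda>t. tuple_unit (i t, fst w t, snd u t)) (\<lambda>t. tuple_unit (j t, snd w t, fst u t))"
  fix g1 :: "'n \<Rightarrow> 'n \<Rightarrow> 'k" and g2 :: "'m \<Rightarrow> 'm \<Rightarrow> 'k" and u w :: "(nat \<Rightarrow> 'n) \<times> (nat \<Rightarrow> 'm)"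
  define A where "A = (\<chi> a b. g1 a b)"
  define B where "B = (\<chi> a b. g2 a b)"
  let ?q = "\<lambda>t. tuple_unit (i t, fst w t, snd u t)" and ?r = "\<lambda>t. tuple_unit (j t, snd w t, fst u t)"
  have "(\<Sum>v\<in>?Y \<times> ?Y. ?T u v * ((\<Prod>t<s. g1 (fst v t) (fst w t)) * (\<Prod>t<s. g2 (snd v t) (snd w t))))
    = (\<Sum>a\<in>?Y. \<Sum>e\<in>?Y. (\<Prod>t<s. A $ a t $ fst w t) * (\<Prod>t<s. B $ e t $ snd w t) *
        ?\<Phi> (\<lambda>t. tuple_unit (i t, a t, snd u t)) (\<lambda>t. tuple_unit (j t, e t, fst u t)))"
    unfolding sum.cartesian_product
    by (intro sum.cong refl) (simp add: A_def B_def case_prod_beta mult_ac)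
  also have "\<dots> = ?\<Phi> (\<lambda>t. left_mul A (?q t)) (\<lambda>t. left_mul B (?r t))"
    unfolding left_mul_tuple_unit by (rule polarization_multilinear[symmetric]) simp_all
  also have "\<dots> = ?\<Phi> (\<lambda>t. right_mul (?q t) B) (\<lambda>t. right_mul (?r t) A)"
    by (rule polarization_exchange[OF len exch])
  also have "\<dots> = (\<Sum>b\<in>?Y. \<Sum>g\<in>?Y. (\<Prod>t<s. B $ snd u t $ b t) * (\<Prod>t<s. A $ fst u t $ g t) *
        ?\<Phi> (\<lambda>t. tuple_unit (i t, fst w t, b t)) (\<lambda>t. tuple_unit (j t, snd w t, g t)))"
    unfolding right_mul_tuple_unit by (rule polarization_multilinear) simp_all
  also have "\<dots> = (\<Sum>v\<in>?Y \<times> ?Y. ((\<Prod>t<s. g1 (fst u t) (fst v t)) * (\<Prod>t<s. g2 (snd u t) (snd v t))) * ?T v w)"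
    by (subst sum.swap, unfold sum.cartesian_product, intro sum.cong refl)
      (simp add: A_def B_def case_prod_beta mult_ac)
  finally show "(\<Sum>v\<in>?Y \<times> ?Y. ?T u v * ((\<Prod>t<s. g1 (fst v t) (fst w t)) * (\<Prod>t<s. g2 (snd v t) (snd w t))))
    = (\<Sum>v\<in>?Y \<times> ?Y. ((\<Prod>t<s. g1 (fst u t) (fst v t)) * (\<Prod>t<s. g2 (snd u t) (snd v t))) * ?T v w)" .
qed simp

section \<open>From permutations to traces\<close>

text \<open>Summing over e glues \<open>Q\<close> at slot t to \<open>R\<close> at slot
  \<open>\<tau> t\<close>. What remains are words of length one, contracted along
  \<open>\<sigma> \<circ> \<tau>\<close>.\<close>

lemma permutation_contraction_mem_traces:
  fixes i j :: "nat \<Rightarrow> 'd::finite"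
  assumes \<sigma>: "\<sigma> permutes {..<s}" and \<tau>: "\<tau> permutes {..<s}"
  shows "(\<lambda>w. \<Sum>a\<in>{..<s} \<rightarrow>\<^sub>E UNIV. \<Sum>e\<in>{..<s} \<rightarrow>\<^sub>E UNIV.
      (\<Prod>t<s. fst w $ i t $ a t $ e (\<tau> t)) * (\<Prod>t<s. snd w $ j t $ e t $ a (\<sigma> t)))
    \<in> alg_generated {trace_fun ps :: ('k::field, 'n::finite, 'm::finite, 'd) W \<Rightarrow> 'k | ps. ps \<noteq> []}"
proof -
  let ?L = "\<lambda>t. [(i t, j (\<tau> t))]"
  have "(\<Sum>a\<in>{..<s} \<rightarrow>\<^sub>E UNIV. \<Sum>e\<in>{..<s} \<rightarrow>\<^sub>E UNIV.
      (\<Prod>t<s. fst w $ i t $ a t $ e (\<tau> t)) * (\<Prod>t<s. snd w $ j t $ e t $ a (\<sigma> t)))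
    = (\<Sum>a\<in>{..<s} \<rightarrow>\<^sub>E UNIV. \<Prod>t<s. word_matrix (?L t) w $ a t $ a ((\<sigma> \<circ> \<tau>) t))"
    for w :: "('k, 'n, 'm, 'd) W"
  proof (intro sum.cong refl)
    fix a :: "nat \<Rightarrow> 'n"
    have "(\<Sum>e\<in>{..<s} \<rightarrow>\<^sub>E UNIV. (\<Prod>t<s. fst w $ i t $ a t $ e (\<tau> t)) * (\<Prod>t<s. snd w $ j t $ e t $ a (\<sigma> t)))
      = (\<Sum>e\<in>{..<s} \<rightarrow>\<^sub>E UNIV. \<Prod>t<s. fst w $ i t $ a t $ (e \<circ> \<tau>) t * snd w $ j (\<tau> t) $ (e \<circ> \<tau>) t $ a ((\<sigma> \<circ> \<tau>) t))"
      using prod.permute[OF \<tau>, of "\<lambda>t. snd w $ j t $ e t $ a (\<sigma> t)" for e]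
      by (simp add: prod.distrib o_def)
    also have "\<dots> = (\<Sum>e\<in>{..<s} \<rightarrow>\<^sub>E UNIV. \<Prod>t<s. fst w $ i t $ a t $ e t * snd w $ j (\<tau> t) $ e t $ a ((\<sigma> \<circ> \<tau>) t))"
      by (rule sum.reindex_bij_betw[OF bij_betw_comp_permutes_PiE[OF \<tau>],
        of "\<lambda>e. \<Prod>t<s. fst w $ i t $ a t $ e t * snd w $ j (\<tau> t) $ e t $ a ((\<sigma> \<circ> \<tau>) t)"])
    also have "\<dots> = (\<Prod>t<s. \<Sum>e\<in>UNIV. fst w $ i t $ a t $ e * snd w $ j (\<tau> t) $ e $ a ((\<sigma> \<circ> \<tau>) t))"
      by (rule prod_sum_PiE[symmetric]) simp_all
    also have "\<dots> = (\<Prod>t<s. word_matrix (?L t) w $ a t $ a ((\<sigma> \<circ> \<tau>) t))"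
      by (simp add: word_matrix_Cons) (simp add: matrix_matrix_mult_def)
    finally show "(\<Sum>e\<in>{..<s} \<rightarrow>\<^sub>E UNIV. (\<Prod>t<s. fst w $ i t $ a t $ e (\<tau> t)) * (\<Prod>t<s. snd w $ j t $ e t $ a (\<sigma> t)))
      = (\<Prod>t<s. word_matrix (?L t) w $ a t $ a ((\<sigma> \<circ> \<tau>) t))" .
  qed
  then show ?thesis
    using cyclic_contraction_mem_traces[OF finite_lessThan permutes_compose[OF \<tau> \<sigma>], of ?L] by simp
qed

lemma sum_reorder4:
  "(\<Sum>a\<in>A. \<Sum>b\<in>B. \<Sum>j\<in>J. \<Sum>e\<in>E. F a b j e) = (\<Sum>j\<in>J. \<Sum>a\<in>A. \<Sum>e\<in>E. \<Sum>b\<in>B. F a b j e)"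
proof -
  have "(\<Sum>b\<in>B. \<Sum>j\<in>J. \<Sum>e\<in>E. F a b j e) = (\<Sum>j\<in>J. \<Sum>e\<in>E. \<Sum>b\<in>B. F a b j e)" for a
    by (subst sum.swap) (intro sum.cong refl sum.swap)
  then show ?thesis by (simp only: sum.swap[of _ A J])
qed

text \<open>The diagonal of the polarization is expanded in matrix units. Each coefficient is a
  combination of permutation matrices, whose entries collapse the sums over column indices into
  contractions.\<close>

lemma homogeneous_exchange_mem_traces:
  fixes ms :: "('k::field_char_0 \<times> ('d::finite \<times> 'n::finite \<times> 'm::finite) list \<times> ('d \<times> 'm \<times> 'n) list) list"
  assumes len: "\<And>c us vs. (c, us, vs) \<in> set ms \<Longrightarrow> length us = s \<and> length vs = s"
    and exch: "\<And>g1 g2 Q R. (\<Sum>m\<leftarrow>ms. monomial_eval m (left_mul g1 Q, left_mul g2 R))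
      = (\<Sum>m\<leftarrow>ms. monomial_eval m (right_mul Q g2, right_mul R g1))"
  shows "(\<lambda>w. \<Sum>m\<leftarrow>ms. monomial_eval m w) \<in> alg_generated {trace_fun ps | ps. ps \<noteq> []}"
proof -
  let ?\<Phi> = "polarization s ms"
  let ?I = "{..<s} \<rightarrow>\<^sub>E (UNIV :: 'd set)" and ?N = "{..<s} \<rightarrow>\<^sub>E (UNIV :: 'n set)"
    and ?M = "{..<s} \<rightarrow>\<^sub>E (UNIV :: 'm set)"
  let ?X = "?N \<times> ?M"
  let ?G = "{\<sigma>. \<sigma> permutes {..<s}} \<times> {\<tau>. \<tau> permutes {..<s}}"
  let ?T = "\<lambda>i j u w. ?\<Phi> (\<lambda>t. tuple_unit (i t, fst w t, snd u t)) (\<lambda>t. tuple_unit (j t, snd w t, fst u t))"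
  define is_coeff where "is_coeff i j l \<longleftrightarrow> (\<forall>u\<in>?X. \<forall>w\<in>?X.
      ?T i j u w = (\<Sum>h\<in>?G. l h * (if u = permute_pair h w then 1 else 0)))" for i j l
  have "\<exists>l. is_coeff i j l" for i j
    unfolding is_coeff_def by (rule polarization_coefficients_permutations[OF len exch])
  then obtain l where coeff: "is_coeff i j (l i j)" for i j by metis
  have l: "?T i j u w = (\<Sum>h\<in>?G. l i j h * (if u = permute_pair h w then 1 else 0))"
    if "u \<in> ?X" "w \<in> ?X" for i j u w
    by (rule coeff[unfolded is_coeff_def, THEN bspec, THEN bspec]) fact+
  let ?C = "\<lambda>w i j h. \<Sum>a\<in>?N. \<Sum>e\<in>?M.
      (\<Prod>t<s. fst w $ i t $ a t $ e (snd h t)) * (\<Prod>t<s. snd w $ j t $ e t $ a (fst h t))"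
  have expand: "?\<Phi> (\<lambda>_. fst w) (\<lambda>_. snd w) = (\<Sum>i\<in>?I. \<Sum>j\<in>?I. \<Sum>h\<in>?G. l i j h * ?C w i j h)"
    for w :: "('k, 'n, 'm, 'd) W"
  proof -
    let ?q = "\<lambda>i a b. \<Prod>t<s. fst w $ i t $ a t $ b t" and ?r = "\<lambda>j e g. \<Prod>t<s. snd w $ j t $ e t $ g t"
    have "?\<Phi> (\<lambda>_. fst w) (\<lambda>_. snd w)
      = ?\<Phi> (\<lambda>_. \<Sum>p\<in>UNIV. scale_tuple (tuple_coord (fst w) p) (tuple_unit p))
          (\<lambda>_. \<Sum>p\<in>UNIV. scale_tuple (tuple_coord (snd w) p) (tuple_unit p))"
      by (simp add: tuple_expansion[symmetric])
    also have "\<dots> = (\<Sum>\<alpha>\<in>{..<s} \<rightarrow>\<^sub>E UNIV. \<Sum>\<beta>\<in>{..<s} \<rightarrow>\<^sub>E UNIV.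
        (\<Prod>t<s. tuple_coord (fst w) (\<alpha> t)) * (\<Prod>t<s. tuple_coord (snd w) (\<beta> t))
        * ?\<Phi> (\<lambda>t. tuple_unit (\<alpha> t)) (\<lambda>t. tuple_unit (\<beta> t)))"
      by (rule polarization_multilinear) simp_all
    \<comment> \<open>Slots of Q split into (i, a, b) and slots of R into (j, e, g). In the crossed
      order the column pair is (g, b) and the row pair (a, e).\<close>
    also have "\<dots> = (\<Sum>i\<in>?I. \<Sum>a\<in>?N. \<Sum>b\<in>?M. \<Sum>j\<in>?I. \<Sum>e\<in>?M. \<Sum>g\<in>?N.
        ?q i a b * ?r j e g * ?T i j (g, b) (a, e))"
      unfolding sum_PiE_triple
      by (intro sum.cong refl arg_cong2[where f = "(*)"] prod.cong polarization_cong)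
        (auto simp: tuple_coord_def)
    also have "\<dots> = (\<Sum>i\<in>?I. \<Sum>j\<in>?I. \<Sum>a\<in>?N. \<Sum>e\<in>?M. \<Sum>b\<in>?M. \<Sum>g\<in>?N.
        ?q i a b * ?r j e g * ?T i j (g, b) (a, e))"
      by (intro sum.cong refl sum_reorder4)
    also have "\<dots> = (\<Sum>i\<in>?I. \<Sum>j\<in>?I. \<Sum>a\<in>?N. \<Sum>e\<in>?M. \<Sum>h\<in>?G.
        l i j h * (?q i a (e \<circ> snd h) * ?r j e (a \<circ> fst h)))"
    proof (intro sum.cong refl)
      fix i j a e assume a: "a \<in> ?N" and e: "e \<in> ?M"
      have "(\<Sum>b\<in>?M. \<Sum>g\<in>?N. ?q i a b * ?r j e g * ?T i j (g, b) (a, e))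
        = (\<Sum>b\<in>?M. \<Sum>g\<in>?N. \<Sum>h\<in>?G. l i j h * (?q i a b * ?r j e g * 
             (if (g, b) = permute_pair h (a, e) then 1 else 0)))"
        using a e by (intro sum.cong refl, subst l) (simp_all add: sum_distrib_left mult_ac)
      also have "\<dots> = (\<Sum>h\<in>?G. \<Sum>b\<in>?M. \<Sum>g\<in>?N. l i j h * (?q i a b * ?r j e g * 
             (if (g, b) = permute_pair h (a, e) then 1 else 0)))"
        by (rule trans[OF sum.cong[OF refl sum.swap] sum.swap])
      also have "\<dots> = (\<Sum>h\<in>?G. l i j h * (?q i a (e \<circ> snd h) * ?r j e (a \<circ> fst h)))"
      proof (intro sum.cong refl)
        fix h assume h: "h \<in> ?G"
        then have perm: "fst h permutes {..<s}" "snd h permutes {..<s}" by auto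
        have mem: "a \<circ> fst h \<in> ?N" "e \<circ> snd h \<in> ?M"
          using bij_betw_apply[OF bij_betw_comp_permutes_PiE[OF perm(1)] a]
            bij_betw_apply[OF bij_betw_comp_permutes_PiE[OF perm(2)] e] by simp_all
        \<comment> \<open>The permutation matrix of h leaves a single term: the columns of R are the
          rows of Q permuted by \<open>fst h\<close>, and the columns of Q are the rows of R
          permuted by \<open>snd h\<close>.\<close>
        have "(\<Sum>b\<in>?M. \<Sum>g\<in>?N. l i j h * (?q i a b * ?r j e g * (if (g, b) = permute_pair h (a, e) then 1 else 0)))
          = (\<Sum>b\<in>?M. \<Sum>g\<in>?N. if g = a \<circ> fst h then if b = e \<circ> snd h then l i j h * (?q i a b * ?r j e g) else 0 else 0)"
          by (intro sum.cong refl) (auto simp: permute_pair_def case_prod_beta)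
        also have "\<dots> = l i j h * (?q i a (e \<circ> snd h) * ?r j e (a \<circ> fst h))"
          using mem by (simp add: sum.delta finite_PiE)
        finally show "(\<Sum>b\<in>?M. \<Sum>g\<in>?N. l i j h * (?q i a b * ?r j e g * (if (g, b) = permute_pair h (a, e) then 1 else 0)))
          = l i j h * (?q i a (e \<circ> snd h) * ?r j e (a \<circ> fst h))" .
      qed
      finally show "(\<Sum>b\<in>?M. \<Sum>g\<in>?N. ?q i a b * ?r j e g * ?T i j (g, b) (a, e))
        = (\<Sum>h\<in>?G. l i j h * (?q i a (e \<circ> snd h) * ?r j e (a \<circ> fst h)))" .
    qed
    also have "\<dots> = (\<Sum>i\<in>?I. \<Sum>j\<in>?I. \<Sum>h\<in>?G. l i j h * ?C w i j h)"
    proof (intro sum.cong refl)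
      fix i j
      have "(\<Sum>a\<in>?N. \<Sum>e\<in>?M. \<Sum>h\<in>?G. l i j h * (?q i a (e \<circ> snd h) * ?r j e (a \<circ> fst h)))
        = (\<Sum>h\<in>?G. \<Sum>a\<in>?N. \<Sum>e\<in>?M. l i j h * (?q i a (e \<circ> snd h) * ?r j e (a \<circ> fst h)))"
        by (rule trans[OF sum.cong[OF refl sum.swap] sum.swap])
      then show "(\<Sum>a\<in>?N. \<Sum>e\<in>?M. \<Sum>h\<in>?G. l i j h * (?q i a (e \<circ> snd h) * ?r j e (a \<circ> fst h)))
        = (\<Sum>h\<in>?G. l i j h * ?C w i j h)"
        by (simp add: sum_distrib_left)
    qed
    finally show ?thesis .
  qed
  let ?A = "alg_generated {trace_fun ps :: ('k, 'n, 'm, 'd) W \<Rightarrow> 'k | ps. ps \<noteq> []}"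
  have C: "(\<lambda>w. ?C w i j h) \<in> ?A" if "h \<in> ?G" for i j h
    by (rule permutation_contraction_mem_traces) (use that in auto)
  have "(\<lambda>w. \<Sum>h\<in>?G. l i j h * ?C w i j h) \<in> ?A" for i j
    by (rule alg_generated_sum, rule alg_generated_scale, rule C)
  then have "(\<lambda>w. \<Sum>i\<in>?I. \<Sum>j\<in>?I. \<Sum>h\<in>?G. l i j h * ?C w i j h) \<in> ?A"
    by (intro alg_generated_sum[where I = ?I])
  \<comment> \<open>The scalar undoes the factor from \<open>polarization_const\<close>.\<close>
  then have "(\<lambda>w. 1 / (fact s)\<^sup>2 * ?\<Phi> (\<lambda>_. fst w) (\<lambda>_. snd w))
    \<in> alg_generated {trace_fun ps :: ('k, 'n, 'm, 'd) W \<Rightarrow> 'k | ps. ps \<noteq> []}"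
    unfolding expand by (rule alg_generated_scale)
  then show ?thesis by (simp add: polarization_const[OF len])
qed

theorem mainTheorem3:
  shows "(invariantsW ::
      (('k::{alg_closed_field, field_char_0}, 'n::finite, 'm::finite, 'd::finite) W \<Rightarrow> 'k) set)
    = alg_generated {trace_fun ps | ps. ps \<noteq> []}"
proof
  show "invariantsW \<subseteq> alg_generated {trace_fun ps :: ('k, 'n, 'm, 'd) W \<Rightarrow> 'k | ps. ps \<noteq> []}"
  proof
    fix f :: "('k, 'n, 'm, 'd) W \<Rightarrow> 'k"
    assume "f \<in> invariantsW"
    then show "f \<in> alg_generated {trace_fun ps | ps. ps \<noteq> []}"
    proof (rule invariantsW_bihomogeneous)
      fix N :: nat and ms
      assume len: "\<And>s c us vs. (c, us, vs) \<in> set (ms s) \<Longrightarrow> length us = s \<and> length vs = s"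
        and f: "\<And>w. f w = (\<Sum>s\<le>N. \<Sum>m\<leftarrow>ms s. monomial_eval m w)"
        and exch: "\<And>s g1 g2 Q R. s \<le> N \<Longrightarrow>
          (\<Sum>m\<leftarrow>ms s. monomial_eval m (left_mul g1 Q, left_mul g2 R))
          = (\<Sum>m\<leftarrow>ms s. monomial_eval m (right_mul Q g2, right_mul R g1))"
      have "(\<lambda>w. \<Sum>s\<le>N. \<Sum>m\<leftarrow>ms s. monomial_eval m w) \<in> alg_generated {trace_fun ps | ps. ps \<noteq> []}"
        using len exch by (intro alg_generated_sum homogeneous_exchange_mem_traces) auto
      moreover have "f = (\<lambda>w. \<Sum>s\<le>N. \<Sum>m\<leftarrow>ms s. monomial_eval m w)" by (rule ext) (rule f)
      ultimately show ?thesis by simp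
    qed
  qed
qed (rule alg_generated_traces_subset_invariantsW)

end
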